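(* Suppose that the past assortments are nested, $S_1\subset\cdots\subset S_M$, and that $S_1,\dots,S_M\in\mathcal{S}$. Then the optimistic optimization problem $\max_{S\in\mathcal{S}}\max_{\lambda\in\mathcal{U}}\mathscr{R}^\lambda(S)$ can be reformulated as a mixed-integer linear optimization problem with $\mathcal{O}(n)$ binary decision variables, $\mathcal{O}(\mathrm{poly}(n,M))$ continuous decision variables, and $\mathcal{O}(\mathrm{poly}(n,M))$ constraints.
   Context: Products: $\mathcal{N}=\{1,\dots,n\}$, and $0$ is the no-purchase option; $\mathcal{N}_0=\mathcal{N}\cup\{0\}$. Revenues satisfy $0=r_0<r_1<\cdots<r_n$. An assortment is a subset of $\mathcal{N}_0$, and $\mathcal{S}=\{S\subseteq\mathcal{N}_0: 0\in S\}$. Data: past assortments $S_1,\dots,S_M\subseteq\mathcal{N}_0$ with index set $\mathcal{M}=\{1,\dots,M\}$, and historical sales data $v_{m,i}\in[0,1]$ ($m\in\mathcal{M}$, $i\in\mathcal{N}_0$) with $\sum_{i\in\mathcal{N}_0}v_{m,i}=1$ for each $m$ and $v_{m,i}=0$ for $i\notin S_m$. Ranking-based choice models: $\Sigma$ is the set of all rankings, i.e. bijections $\sigma:\mathcal{N}_0\to\{0,\dots,n\}$. $\Delta_\Sigma$ is the set of probability distributions $\lambda=(\lambda_\sigma)_{\sigma\in\Sigma}$ on $\Sigma$. For $\lambda\in\Delta_\Sigma$ and an assortment $S$, $\mathscr{D}^\lambda_i(S)=\sum_{\sigma\in\Sigma}\mathbb{I}\{i=\arg\min_{j\in S}\sigma(j)\}\lambda_\sigma$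 and $\mathscr{R}^\lambda(S)=\sum_{i\in\mathcal{N}_0}r_i\mathscr{D}^\lambda_i(S)$. Uncertainty set: for a radius $\eta\ge 0$ and $\|\cdot\|$ either the $\ell_1$- or $\ell_\infty$-norm, $\mathcal{U}$ is the set of $\lambda\in\Delta_\Sigma$ for which there is a vector $\epsilon=(\epsilon_{m,i})_{m\in\mathcal{M},i\in S_m}$ with $\|\epsilon\|\le\eta$ and $\mathscr{D}^\lambda_i(S_m)-v_{m,i}=\epsilon_{m,i}$ for all $m\in\mathcal{M}$, $i\in S_m$. Standing assumption: $\mathcal{U}\neq\emptyset$. "Can be reformulated as" means equivalence of optimization problems: equal optimal values, with an optimal assortment recoverable from the binary decision variables of an optimal solution. *)

theory Defs
  imports Complex_Main "HOL-Combinatorics.Permutations"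
begin

section \<open>Ranking-based choice models\<close>

text \<open>The set of all assortments that contain the no-purchase option \<open>0\<close>; the products
  are \<open>1, \<dots>, n\<close>.\<close>

definition assortments :: "nat \<Rightarrow> nat set set" where
  "assortments n = {S. S \<subseteq> {0..n} \<and> 0 \<in> S}"

text \<open>Using permutations (the identity outside \<open>{0..n}\<close>) gives exactly one HOL function for
  every bijection from \<open>{0..n}\<close> to \<open>{0..n}\<close>, so that sums over rankings are finite.\<close>

definition rankings :: "nat \<Rightarrow> (nat \<Rightarrow> nat) set" where
  "rankings n = {\<sigma>. \<sigma> permutes {0..n}}"

definition distributions :: "nat \<Rightarrow> ((nat \<Rightarrow> nat) \<Rightarrow> real) set" where
  "distributions n =
     {lam. (\<forall>\<sigma>\<in>rankings n. 0 \<le> lam \<sigma>) \<and> (\<Sum>\<sigma>\<in>rankings n. lam \<sigma>) = 1}"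

definition demand :: "nat \<Rightarrow> ((nat \<Rightarrow> nat) \<Rightarrow> real) \<Rightarrow> nat \<Rightarrow> nat set \<Rightarrow> real" where
  "demand n lam i S = (\<Sum>\<sigma>\<in>rankings n. of_bool (i = arg_min_on \<sigma> S) * lam \<sigma>)"

definition revenue ::
  "nat \<Rightarrow> (nat \<Rightarrow> real) \<Rightarrow> ((nat \<Rightarrow> nat) \<Rightarrow> real) \<Rightarrow> nat set \<Rightarrow> real" where
  "revenue n r lam S = (\<Sum>i\<in>{0..n}. r i * demand n lam i S)"

section \<open>Data and uncertainty set\<close>

datatype norm_kind = L1 | Linf

fun vec_norm :: "norm_kind \<Rightarrow> 'a set \<Rightarrow> ('a \<Rightarrow> real) \<Rightarrow> real" where
  "vec_norm L1 I \<epsilon> = (\<Sum>p\<in>I. \<bar>\<epsilon> p\<bar>)"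
| "vec_norm Linf I \<epsilon> = Max ((\<lambda>p. \<bar>\<epsilon> p\<bar>) ` I)"

definition uncertainty_set ::
  "norm_kind \<Rightarrow> nat \<Rightarrow> nat \<Rightarrow> (nat \<Rightarrow> nat set) \<Rightarrow> (nat \<Rightarrow> nat \<Rightarrow> real) \<Rightarrow> real
     \<Rightarrow> ((nat \<Rightarrow> nat) \<Rightarrow> real) set" where
  "uncertainty_set nk n M S v \<eta> =
     {lam \<in> distributions n. \<exists>\<epsilon> :: nat \<times> nat \<Rightarrow> real.
        vec_norm nk (Sigma {1..M} S) \<epsilon> \<le> \<eta> \<and>
        (\<forall>m\<in>{1..M}. \<forall>i\<in>S m. demand n lam i (S m) - v m i = \<epsilon> (m, i))}"

definition valid_revenues :: "nat \<Rightarrow> (nat \<Rightarrow> real) \<Rightarrow> bool" where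
  "valid_revenues n r \<longleftrightarrow> r 0 = 0 \<and> strict_mono_on {0..n} r"

definition valid_sales ::
  "nat \<Rightarrow> nat \<Rightarrow> (nat \<Rightarrow> nat set) \<Rightarrow> (nat \<Rightarrow> nat \<Rightarrow> real) \<Rightarrow> bool" where
  "valid_sales n M S v \<longleftrightarrow>
     (\<forall>m\<in>{1..M}. (\<forall>i\<in>{0..n}. 0 \<le> v m i \<and> v m i \<le> 1) \<and>
                 (\<Sum>i\<in>{0..n}. v m i) = 1 \<and>
                 (\<forall>i\<in>{0..n} - S m. v m i = 0))"

section \<open>Mixed-integer linear optimization problems\<close>

text \<open>Maximize a linear function of binary variables \<open>x 1, \<dots>, x nbin\<close> and continuous variables
  \<open>y 1, \<dots>, y ncont\<close> subject to \<open>nrows\<close> linear inequalities. Equations and sign restrictions on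
  the continuous variables have to be expressed by (and counted as) inequalities.\<close>

record milp =
  nbin :: nat
  ncont :: nat
  nrows :: nat
  cost_bin :: "nat \<Rightarrow> real"
  cost_cont :: "nat \<Rightarrow> real"
  coef_bin :: "nat \<Rightarrow> nat \<Rightarrow> real"
  coef_cont :: "nat \<Rightarrow> nat \<Rightarrow> real"
  rhs :: "nat \<Rightarrow> real"

definition milp_feasible :: "milp \<Rightarrow> ((nat \<Rightarrow> real) \<times> (nat \<Rightarrow> real)) set" where
  "milp_feasible P = {(x, y).
     (\<forall>j\<in>{1..nbin P}. x j \<in> {0, 1}) \<and>
     (\<forall>k\<in>{1..nrows P}.
        (\<Sum>j\<in>{1..nbin P}. coef_bin P k j * x j) +
        (\<Sum>j\<in>{1..ncont P}. coef_cont P k j * y j) \<le> rhs P k)}"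

definition milp_objective :: "milp \<Rightarrow> (nat \<Rightarrow> real) \<times> (nat \<Rightarrow> real) \<Rightarrow> real" where
  "milp_objective P = (\<lambda>(x, y).
     (\<Sum>j\<in>{1..nbin P}. cost_bin P j * x j) + (\<Sum>j\<in>{1..ncont P}. cost_cont P j * y j))"

section \<open>Reformulations\<close>

definition is_max :: "real set \<Rightarrow> real \<Rightarrow> bool" where
  "is_max X z \<longleftrightarrow> z \<in> X \<and> (\<forall>w\<in>X. w \<le> z)"

text \<open>The assortment encoded by the first \<open>n\<close> binary variables.\<close>

definition assortment_of :: "nat \<Rightarrow> (nat \<Rightarrow> real) \<Rightarrow> nat set" where
  "assortment_of n x = insert 0 {i \<in> {1..n}. x i = 1}"

text \<open>\<open>P\<close> has the same (attained) optimal value as the optimistic problem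
  of maximizing \<open>revenue n r lam S\<close> over assortments \<open>S\<close> and distributions \<open>lam \<in> U\<close>, and the
  binary variables of every optimal solution of \<open>P\<close> encode an optimal assortment.\<close>

definition reformulates_optimistic ::
  "nat \<Rightarrow> (nat \<Rightarrow> real) \<Rightarrow> ((nat \<Rightarrow> nat) \<Rightarrow> real) set \<Rightarrow> milp \<Rightarrow> bool" where
  "reformulates_optimistic n r U P \<longleftrightarrow>
     n \<le> nbin P \<and>
     (\<exists>z. is_max {revenue n r lam S | S lam. S \<in> assortments n \<and> lam \<in> U} z \<and>
          is_max (milp_objective P ` milp_feasible P) z \<and>
          (\<forall>(x, y)\<in>milp_feasible P. milp_objective P (x, y) = z \<longrightarrow>
             is_max ((\<lambda>lam. revenue n r lam (assortment_of n x)) ` U) z))"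

text \<open>Without a restriction on how the problem \<open>P\<close> is obtained from the data, every
  problem would have a reformulation of constant size with its optimal value hard-wired. The
  reformulation is therefore required to be a template: for given \<open>n\<close>, \<open>M\<close>, past assortments and
  norm, its dimensions are fixed and its coefficients are affine functions of the numerical
  data \<open>(r, v, \<eta>)\<close>.\<close>

type_synonym num_data = "(nat \<Rightarrow> real) \<times> (nat \<Rightarrow> nat \<Rightarrow> real) \<times> real"

definition affine_in_data :: "nat \<Rightarrow> nat \<Rightarrow> (num_data \<Rightarrow> real) \<Rightarrow> bool" where
  "affine_in_data n M f \<longleftrightarrow>
     (\<exists>c a b g. \<forall>r v \<eta>. f (r, v, \<eta>) =
        c + (\<Sum>i\<in>{0..n}. a i * r i) + (\<Sum>m\<in>{1..M}. \<Sum>i\<in>{0..n}. b m i * v m i) + g * \<eta>)"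

definition milp_template ::
  "nat \<Rightarrow> nat \<Rightarrow> nat \<Rightarrow> nat \<Rightarrow> nat \<Rightarrow> (num_data \<Rightarrow> milp) \<Rightarrow> bool" where
  "milp_template n M p q k F \<longleftrightarrow>
     (\<forall>D. nbin (F D) = p \<and> ncont (F D) = q \<and> nrows (F D) = k) \<and>
     (\<forall>j\<in>{1..p}. affine_in_data n M (\<lambda>D. cost_bin (F D) j)) \<and>
     (\<forall>j\<in>{1..q}. affine_in_data n M (\<lambda>D. cost_cont (F D) j)) \<and>
     (\<forall>l\<in>{1..k}. affine_in_data n M (\<lambda>D. rhs (F D) l)) \<and>
     (\<forall>l\<in>{1..k}. \<forall>j\<in>{1..p}. affine_in_data n M (\<lambda>D. coef_bin (F D) l j)) \<and>
     (\<forall>l\<in>{1..k}. \<forall>j\<in>{1..q}. affine_in_data n M (\<lambda>D. coef_cont (F D) l j))"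

end

theory Submission
  imports Defs "HOL-Analysis.Function_Topology"
begin

text \<open>The past assortments record of a ranking only the tuple of its first choices \<open>i\<^sub>1, \<dots>, i\<^sub>M\<close>.
  As the assortments are nested, such a tuple comes from a ranking if and only if it is a path:
  passing from \<open>S m\<close> to \<open>S (m + 1)\<close>, the choice stays or moves to an added alternative. A path is
  consistent with the choice of \<open>k\<close> from a new assortment \<open>T\<close> if and only if \<open>i\<^sub>m = k\<close> or
  \<open>i\<^sub>m \<notin> T\<close> for every \<open>m\<close> with \<open>k \<in> S m\<close>; the ranking that lists \<open>i\<^sub>M, i\<^sub>M\<^sub>-\<^sub>1, \<dots>\<close>, and inserts
  \<open>k\<close> directly after the choices from those assortments that contain \<open>k\<close>, shows this
  (\<open>ranking_of_choice_path\<close>).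

  A distribution over rankings can therefore be replaced by a distribution over pairs of a path and
  a choice \<open>k\<close> from \<open>T\<close>. Only its one-layer marginals matter, that is, the probability
  \<open>Flow k m i\<close> of choosing \<open>k\<close> from \<open>T\<close> and \<open>i\<close> from \<open>S m\<close>. For fixed \<open>k\<close>, nonnegative numbers
  come from paths if and only if they have the same sum in each layer and \<open>Flow k (m + 1) i \<le> Flow k m i\<close>
  for \<open>i \<in> S m\<close>, which is shown by removing paths one at a time (\<open>mass_profile_realizable\<close>).
  The consistency condition says that certain flows vanish if \<open>j \<in> T\<close>; with the indicator
  \<open>x j\<close> of \<open>j \<in> T\<close>, this is the linear condition \<open>Flow k m j \<le> 1 - x j\<close>, because flows are at most
  \<open>1\<close>. The demand in the past assortments is the sum of the flows over \<open>k\<close>, and the expected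
  revenue is the sum of \<open>r k\<close> times the total mass of \<open>k\<close>, so everything is linear
  and there are cubically many variables and constraints.

  Solutions of the system and pairs of an assortment and a distribution in the uncertainty set thus
  have the same objective values (\<open>distribution_of_solution\<close>, \<open>solution_of_distribution\<close>).
  That the optimal value is attained follows from compactness (\<open>optimum_attained\<close>).\<close>

section \<open>Choices made by rankings\<close>

lemma finite_rankings: "finite (rankings n)"
  by (simp add: rankings_def finite_permutations)

lemma ranking_inj: "\<sigma> \<in> rankings n \<Longrightarrow> inj \<sigma>"
  by (simp add: rankings_def permutes_inj)

lemma arg_min_on_in:
  fixes \<sigma> :: "nat \<Rightarrow> nat"
  assumes "A \<noteq> {}"
  shows "arg_min_on \<sigma> A \<in> A"
  using assms arg_min_natI[of "\<lambda>x. x \<in> A" _ \<sigma>] by (auto simp: arg_min_on_def)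

lemma arg_min_on_le:
  fixes \<sigma> :: "nat \<Rightarrow> nat"
  assumes "j \<in> A"
  shows "\<sigma> (arg_min_on \<sigma> A) \<le> \<sigma> j"
  using assms arg_min_nat_le[of "\<lambda>x. x \<in> A" j \<sigma>] by (auto simp: arg_min_on_def)

lemma arg_min_on_eqI:
  fixes \<sigma> :: "nat \<Rightarrow> nat"
  assumes "inj \<sigma>" "i \<in> A" "\<And>j. j \<in> A \<Longrightarrow> \<sigma> i \<le> \<sigma> j"
  shows "arg_min_on \<sigma> A = i"
proof -
  have "\<sigma> (arg_min_on \<sigma> A) = \<sigma> i"
    using assms(2,3) arg_min_on_in[of A \<sigma>] arg_min_on_le[of i A \<sigma>] by (intro antisym) blast+
  then show ?thesis using assms(1) by (simp add: inj_eq)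
qed

lemma arg_min_on_subset:
  assumes "\<sigma> \<in> rankings n" "A \<subseteq> B" "arg_min_on \<sigma> B \<in> A"
  shows "arg_min_on \<sigma> A = arg_min_on \<sigma> B"
  using assms by (intro arg_min_on_eqI) (auto intro: ranking_inj arg_min_on_le)

lemma move_to_front:
  assumes \<sigma>: "\<sigma> \<in> rankings n" and x: "x \<le> n"
  shows "\<exists>\<tau>\<in>rankings n. \<tau> x = 0 \<and>
    (\<forall>i j. i \<noteq> x \<longrightarrow> j \<noteq> x \<longrightarrow> \<sigma> i \<le> \<sigma> j \<longrightarrow> \<tau> i \<le> \<tau> j)"
proof -
  define \<tau> where "\<tau> i = (if i = x then 0 else if \<sigma> i < \<sigma> x then Suc (\<sigma> i) else \<sigma> i)" for i
  have inj: "\<sigma> i = \<sigma> j \<longleftrightarrow> i = j" for i j using ranking_inj[OF \<sigma>] by (simp add: inj_eq)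
  have perm: "\<sigma> permutes {0..n}" using \<sigma> by (simp add: rankings_def)
  have le: "\<sigma> i \<le> n" if "i \<le> n" for i using permutes_in_image[OF perm, of i] that by simp
  have out: "\<sigma> i = i" if "i > n" for i using permutes_not_in[OF perm, of i] that by simp
  have "inj_on \<tau> {0..n}"
  proof (rule inj_onI)
    fix i j assume "\<tau> i = \<tau> j"
    then show "i = j"
      using inj[of i j] inj[of i x] inj[of j x] by (auto simp: \<tau>_def split: if_splits)
  qed
  moreover have "\<tau> ` {0..n} \<subseteq> {0..n}" using le x le[OF x] by (force simp: \<tau>_def)
  ultimately have "bij_betw \<tau> {0..n} {0..n}"
    by (simp add: bij_betw_def endo_inj_surj)
  moreover have "\<tau> i = i" if "i \<notin> {0..n}" for i
    using that x out[of i] le[OF x] by (auto simp: \<tau>_def)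
  ultimately have "\<tau> \<in> rankings n" by (auto simp: rankings_def intro: bij_imp_permutes)
  moreover have "\<tau> x = 0" by (simp add: \<tau>_def)
  moreover have "\<tau> i \<le> \<tau> j" if "i \<noteq> x" "j \<noteq> x" "\<sigma> i \<le> \<sigma> j" for i j
    using that inj[of i x] inj[of i j] by (auto simp: \<tau>_def)
  ultimately show ?thesis by blast
qed

text \<open>Every priority list extends to a ranking, by moving its members to the front one after
  the other, the last member first. Repetitions in the list do no harm: only the first
  occurrence of an alternative matters.\<close>

lemma ranking_of_list:
  assumes "set xs \<subseteq> {0..n}"
  shows "\<exists>\<sigma>\<in>rankings n. \<forall>A ys x zs.
    xs = ys @ x # zs \<longrightarrow> x \<in> A \<longrightarrow> set ys \<inter> A \<subseteq> {x} \<longrightarrow> arg_min_on \<sigma> A = x"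
  using assms
proof (induction xs)
  case Nil
  have "id \<in> rankings n" by (simp add: rankings_def permutes_id)
  then show ?case by blast
next
  case (Cons a xs)
  then obtain \<sigma> where \<sigma>: "\<sigma> \<in> rankings n" and choice: "\<And>A ys x zs.
    xs = ys @ x # zs \<Longrightarrow> x \<in> A \<Longrightarrow> set ys \<inter> A \<subseteq> {x} \<Longrightarrow> arg_min_on \<sigma> A = x"
    by (metis (no_types, lifting) insert_subset list.simps(15))
  obtain \<tau> where \<tau>: "\<tau> \<in> rankings n" "\<tau> a = 0"
    and mono: "\<And>i j. i \<noteq> a \<Longrightarrow> j \<noteq> a \<Longrightarrow> \<sigma> i \<le> \<sigma> j \<Longrightarrow> \<tau> i \<le> \<tau> j"
    using move_to_front[OF \<sigma>, of a] Cons.prems by auto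
  have "arg_min_on \<tau> A = x"
    if split: "a # xs = ys @ x # zs" and x: "x \<in> A" and ys: "set ys \<inter> A \<subseteq> {x}" for A ys x zs
  proof (cases "a = x")
    case True
    then show ?thesis using x \<tau> by (intro arg_min_on_eqI) (auto intro: ranking_inj)
  next
    case False
    then obtain ys' where ys': "ys = a # ys'" and xs: "xs = ys' @ x # zs"
      using split by (cases ys) auto
    have a: "a \<notin> A" using ys ys' False by auto
    have "arg_min_on \<sigma> A = x" by (rule choice[OF xs x]) (use ys ys' in auto)
    then have "\<sigma> x \<le> \<sigma> j" if "j \<in> A" for j using arg_min_on_le[OF that, of \<sigma>] by simp
    then have "\<tau> x \<le> \<tau> j" if "j \<in> A" for j using mono[of x j] a x that by metis
    then show ?thesis using x \<tau> by (intro arg_min_on_eqI) (auto intro: ranking_inj)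
  qed
  then show ?case using \<tau> by blast
qed

section \<open>Demand as a linear functional of the distribution\<close>

lemma demand_add: "demand n (\<lambda>\<sigma>. \<mu> \<sigma> + \<nu> \<sigma>) i A = demand n \<mu> i A + demand n \<nu> i A"
  by (simp add: demand_def distrib_left sum.distrib)

lemma demand_sum: "demand n (\<lambda>\<sigma>. \<Sum>k\<in>K. \<mu> k \<sigma>) i A = (\<Sum>k\<in>K. demand n (\<mu> k) i A)"
  unfolding demand_def sum_distrib_left by (rule sum.swap)

lemma demand_point:
  assumes "\<sigma> \<in> rankings n"
  shows "demand n (\<lambda>\<tau>. d * of_bool (\<tau> = \<sigma>)) i A = d * of_bool (i = arg_min_on \<sigma> A)"
proof -
  have "demand n (\<lambda>\<tau>. d * of_bool (\<tau> = \<sigma>)) i A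
    = (\<Sum>\<tau>\<in>rankings n. if \<tau> = \<sigma> then d * of_bool (i = arg_min_on \<sigma> A) else 0)"
    unfolding demand_def by (intro sum.cong) auto
  then show ?thesis using assms by (simp add: finite_rankings)
qed

lemma sum_demand:
  assumes "finite I" "A \<subseteq> I" "A \<noteq> {}"
  shows "(\<Sum>i\<in>I. demand n \<mu> i A) = (\<Sum>\<sigma>\<in>rankings n. \<mu> \<sigma>)"
proof -
  have "(\<Sum>i\<in>I. of_bool (i = arg_min_on \<sigma> A) * \<mu> \<sigma>) = \<mu> \<sigma>" for \<sigma> :: "nat \<Rightarrow> nat"
    using arg_min_on_in[OF assms(3), of \<sigma>] assms(1,2)
    by (subst sum_distrib_right[symmetric]) (auto simp: of_bool_def sum.delta)
  then show ?thesis unfolding demand_def by (subst sum.swap) simp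
qed

definition joint_demand ::
  "nat \<Rightarrow> ((nat \<Rightarrow> nat) \<Rightarrow> real) \<Rightarrow> nat \<Rightarrow> nat set \<Rightarrow> nat \<Rightarrow> nat set \<Rightarrow> real" where
  "joint_demand n \<mu> k A i B =
     (\<Sum>\<sigma>\<in>rankings n. of_bool (k = arg_min_on \<sigma> A \<and> i = arg_min_on \<sigma> B) * \<mu> \<sigma>)"

lemma joint_demand_commute: "joint_demand n \<mu> k A i B = joint_demand n \<mu> i B k A"
  unfolding joint_demand_def by (intro sum.cong) auto

lemma sum_joint_demand:
  assumes "finite I" "B \<subseteq> I" "B \<noteq> {}"
  shows "(\<Sum>i\<in>I. joint_demand n \<mu> k A i B) = demand n \<mu> k A"
proof -
  have "(\<Sum>i\<in>I. of_bool (k = arg_min_on \<sigma> A \<and> i = arg_min_on \<sigma> B) * \<mu> \<sigma>)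
    = of_bool (k = arg_min_on \<sigma> A) * \<mu> \<sigma>" for \<sigma> :: "nat \<Rightarrow> nat"
  proof -
    have "(\<Sum>i\<in>I. of_bool (k = arg_min_on \<sigma> A \<and> i = arg_min_on \<sigma> B) * \<mu> \<sigma>)
      = (\<Sum>i\<in>I. if i = arg_min_on \<sigma> B then of_bool (k = arg_min_on \<sigma> A) * \<mu> \<sigma> else 0)"
      by (intro sum.cong) auto
    moreover have "arg_min_on \<sigma> B \<in> I" using arg_min_on_in[OF assms(3)] assms(2) by blast
    ultimately show ?thesis using assms(1) by simp
  qed
  then show ?thesis unfolding demand_def joint_demand_def by (subst sum.swap) (simp only:)
qed

section \<open>Existence of optimistic optima\<close>

lemma vec_norm_cong: "(\<And>p. p \<in> I \<Longrightarrow> f p = g p) \<Longrightarrow> vec_norm nk I f = vec_norm nk I g"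
  by (cases nk) (auto intro!: sum.cong arg_cong[of _ _ Max] image_cong)

text \<open>The error vector is determined by the distribution.\<close>

lemma uncertainty_set_eq:
  "uncertainty_set nk n M S v \<eta> = {lam \<in> distributions n.
     vec_norm nk (Sigma {1..M} S) (\<lambda>(m, i). demand n lam i (S m) - v m i) \<le> \<eta>}"
  (is "_ = {lam \<in> _. ?N lam \<le> _}")
proof (intro set_eqI iffI)
  fix lam assume "lam \<in> uncertainty_set nk n M S v \<eta>"
  then obtain \<epsilon> where "lam \<in> distributions n" "vec_norm nk (Sigma {1..M} S) \<epsilon> \<le> \<eta>"
    and \<epsilon>: "\<And>m i. m \<in> {1..M} \<Longrightarrow> i \<in> S m \<Longrightarrow> demand n lam i (S m) - v m i = \<epsilon> (m, i)"
    by (auto simp: uncertainty_set_def)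
  moreover have "?N lam = vec_norm nk (Sigma {1..M} S) \<epsilon>"
    by (rule vec_norm_cong) (auto simp: \<epsilon>)
  ultimately show "lam \<in> {lam \<in> distributions n. ?N lam \<le> \<eta>}" by simp
next
  fix lam assume "lam \<in> {lam \<in> distributions n. ?N lam \<le> \<eta>}"
  then show "lam \<in> uncertainty_set nk n M S v \<eta>"
    unfolding uncertainty_set_def
    by (auto intro!: exI[of _ "\<lambda>(m, i). demand n lam i (S m) - v m i"])
qed

lemma vec_norm_le_iff:
  assumes "finite I" "I \<noteq> {}"
  shows "vec_norm nk I f \<le> \<eta> \<longleftrightarrow>
    (case nk of L1 \<Rightarrow> (\<Sum>p\<in>I. \<bar>f p\<bar>) \<le> \<eta> | Linf \<Rightarrow> (\<forall>p\<in>I. \<bar>f p\<bar> \<le> \<eta>))"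
  using assms by (cases nk) auto

lemma continuous_on_demand: "continuous_on UNIV (\<lambda>lam. demand n lam i A)"
  unfolding demand_def
  by (intro continuous_on_sum continuous_on_mult continuous_on_const continuous_on_product_coordinates)

lemma compact_cube: "compact {lam :: 'a \<Rightarrow> real. \<forall>\<sigma>. lam \<sigma> \<in> {0..b \<sigma>}}"
proof -
  have "compactin (product_topology (\<lambda>_. euclidean) UNIV) (PiE UNIV (\<lambda>\<sigma>. {0..b \<sigma>} :: real set))"
    by (simp add: compactin_PiE)
  then show ?thesis by (simp add: euclidean_product_topology PiE_def Pi_def)
qed

text \<open>Distributions are arbitrary functions outside the rankings, so compactness only holds for
  those that vanish there; every distribution can be replaced by such a one without changing
  any demand.\<close>

lemma revenue_attains_max:
  fixes S :: "nat \<Rightarrow> nat set"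
  assumes fin: "finite (Sigma {1..M} S)" "Sigma {1..M} S \<noteq> {}"
    and ne: "uncertainty_set nk n M S v \<eta> \<noteq> {}"
  shows "\<exists>lam\<in>uncertainty_set nk n M S v \<eta>. \<forall>lam'\<in>uncertainty_set nk n M S v \<eta>.
    revenue n r lam' A \<le> revenue n r lam A"
proof -
  let ?U = "uncertainty_set nk n M S v \<eta>" and ?J = "Sigma {1..M} S"
  define K where "K = {lam. \<forall>\<sigma>. lam \<sigma> \<in> {0..of_bool (\<sigma> \<in> rankings n) :: real}}"
  define err where "err lam = (\<lambda>(m, i). demand n lam i (S m) - v m i)" for lam
  have [simp]: "err lam p = demand n lam (snd p) (S (fst p)) - v (fst p) (snd p)" for lam p
    by (simp add: err_def split: prod.split)
  have "closed {lam. vec_norm nk ?J (err lam) \<le> \<eta>}"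
  proof (cases nk)
    case L1
    then show ?thesis
      unfolding vec_norm_le_iff[OF fin]
      by (auto intro!: closed_Collect_le continuous_on_sum continuous_intros continuous_on_demand)
  next
    case Linf
    have "{lam. vec_norm nk ?J (err lam) \<le> \<eta>} = (\<Inter>p\<in>?J. {lam. \<bar>err lam p\<bar> \<le> \<eta>})"
      unfolding vec_norm_le_iff[OF fin] using Linf by auto
    then show ?thesis
      by (auto intro!: closed_INT closed_Collect_le continuous_intros continuous_on_demand)
  qed
  moreover have "closed {lam :: (nat \<Rightarrow> nat) \<Rightarrow> real. (\<Sum>\<sigma>\<in>rankings n. lam \<sigma>) = 1}"
    by (intro closed_Collect_eq continuous_on_sum continuous_on_const continuous_on_product_coordinates)
  ultimately have "compact (K \<inter> ({lam. vec_norm nk ?J (err lam) \<le> \<eta>} \<inter>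
      {lam. (\<Sum>\<sigma>\<in>rankings n. lam \<sigma>) = 1}))"
    unfolding K_def by (intro compact_Int_closed closed_Int compact_cube) auto
  moreover have "K \<inter> ({lam. vec_norm nk ?J (err lam) \<le> \<eta>} \<inter>
      {lam. (\<Sum>\<sigma>\<in>rankings n. lam \<sigma>) = 1}) = ?U \<inter> K"
    unfolding uncertainty_set_eq err_def[symmetric]
    by (auto simp: K_def distributions_def)
  ultimately have comp: "compact (?U \<inter> K)" by simp
  define cut where "cut lam \<sigma> = (if \<sigma> \<in> rankings n then lam \<sigma> else 0)"
    for lam :: "(nat \<Rightarrow> nat) \<Rightarrow> real" and \<sigma>
  have dem: "demand n (cut lam) i B = demand n lam i B" for lam i B
    unfolding demand_def cut_def by (intro sum.cong) auto
  have cut: "cut lam \<in> ?U \<inter> K" if "lam \<in> ?U" for lam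
  proof -
    have lam: "lam \<in> distributions n" "vec_norm nk ?J (err lam) \<le> \<eta>"
      using that unfolding uncertainty_set_eq err_def by auto
    have le: "lam \<sigma> \<le> 1" if "\<sigma> \<in> rankings n" for \<sigma>
      using lam(1) member_le_sum[of \<sigma> "rankings n" lam] that
      by (auto simp: distributions_def finite_rankings)
    have "(\<Sum>\<sigma>\<in>rankings n. cut lam \<sigma>) = (\<Sum>\<sigma>\<in>rankings n. lam \<sigma>)"
      by (intro sum.cong) (auto simp: cut_def)
    then have "cut lam \<in> distributions n" using lam(1) by (auto simp: distributions_def cut_def)
    moreover have "err (cut lam) = err lam" by (simp add: err_def dem)
    ultimately have "cut lam \<in> ?U" using lam(2) unfolding uncertainty_set_eq err_def by simp
    moreover have "cut lam \<in> K" using lam(1) le by (auto simp: K_def cut_def distributions_def)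
    ultimately show ?thesis by simp
  qed
  have "continuous_on (?U \<inter> K) (\<lambda>lam. revenue n r lam A)"
    unfolding revenue_def
    by (intro continuous_on_sum continuous_on_mult continuous_on_const
        continuous_on_subset[OF continuous_on_demand]) auto
  then obtain lam where lam: "lam \<in> ?U \<inter> K"
    and max: "\<And>lam'. lam' \<in> ?U \<inter> K \<Longrightarrow> revenue n r lam' A \<le> revenue n r lam A"
    using continuous_attains_sup[OF comp] cut ne by (metis (no_types, lifting) equals0D ex_in_conv)
  have "revenue n r lam' A \<le> revenue n r lam A" if "lam' \<in> ?U" for lam'
    using max[OF cut[OF that]] by (simp add: revenue_def dem)
  then show ?thesis using lam by blast
qed

lemma optimum_attained:
  fixes S :: "nat \<Rightarrow> nat set"
  assumes "finite (Sigma {1..M} S)" "Sigma {1..M} S \<noteq> {}" "uncertainty_set nk n M S v \<eta> \<noteq> {}"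
  shows "\<exists>z. is_max {revenue n r lam A |A lam.
    A \<in> assortments n \<and> lam \<in> uncertainty_set nk n M S v \<eta>} z"
proof -
  let ?U = "uncertainty_set nk n M S v \<eta>"
  obtain opt where opt: "\<And>A. opt A \<in> ?U"
    and max: "\<And>A lam. lam \<in> ?U \<Longrightarrow> revenue n r lam A \<le> revenue n r (opt A) A"
    using revenue_attains_max[OF assms] by metis
  have fin: "finite (assortments n)"
    by (rule finite_subset[of _ "Pow {0..n}"]) (auto simp: assortments_def)
  have "{0} \<in> assortments n" by (simp add: assortments_def)
  then have "Max ((\<lambda>A. revenue n r (opt A) A) ` assortments n)
      \<in> (\<lambda>A. revenue n r (opt A) A) ` assortments n"
    using fin by (intro Max_in) auto
  then obtain B where B: "B \<in> assortments n"
    "revenue n r (opt B) B = Max ((\<lambda>A. revenue n r (opt A) A) ` assortments n)" by auto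
  have "revenue n r lam A \<le> revenue n r (opt B) B" if "A \<in> assortments n" "lam \<in> ?U" for A lam
  proof -
    have "revenue n r (opt A) A \<le> revenue n r (opt B) B" using B(2) fin that(1) by simp
    then show ?thesis using max[OF that(2), of A] by simp
  qed
  then have "is_max {revenue n r lam A |A lam. A \<in> assortments n \<and> lam \<in> ?U} (revenue n r (opt B) B)"
    using B(1) opt by (force simp: is_max_def)
  then show ?thesis by blast
qed

section \<open>Mass profiles along nested assortments\<close>

locale nested_assortments =
  fixes n M :: nat and S :: "nat \<Rightarrow> nat set"
  assumes M_pos: "1 \<le> M"
    and S_assortment: "m \<in> {1..M} \<Longrightarrow> S m \<in> assortments n"
    and S_step: "m \<in> {1..<M} \<Longrightarrow> S m \<subseteq> S (Suc m)"
begin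

abbreviation cells :: "(nat \<times> nat) set" where
  "cells \<equiv> Sigma {1..M} S"

lemma S_subset: "m \<in> {1..M} \<Longrightarrow> S m \<subseteq> {0..n}"
  using S_assortment by (auto simp: assortments_def)

lemma zero_in_S: "m \<in> {1..M} \<Longrightarrow> 0 \<in> S m"
  using S_assortment by (auto simp: assortments_def)

lemma finite_S: "m \<in> {1..M} \<Longrightarrow> finite (S m)"
  using S_subset finite_subset by blast

lemma finite_cells: "finite cells"
  using finite_S by auto

lemma cells_nonempty: "cells \<noteq> {}"
proof -
  have "(1, 0) \<in> cells" using M_pos zero_in_S[of 1] by simp
  then show ?thesis by blast
qed

lemma S_mono: "1 \<le> l \<Longrightarrow> l \<le> m \<Longrightarrow> m \<le> M \<Longrightarrow> S l \<subseteq> S m"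
proof (induction m)
  case (Suc m)
  show ?case
  proof (cases "l = Suc m")
    case False
    then have "S l \<subseteq> S m" using Suc by simp
    moreover have "S m \<subseteq> S (Suc m)" using Suc.prems False by (intro S_step) simp
    ultimately show ?thesis by simp
  qed simp
qed simp

text \<open>The choices that one ranking can make from the past assortments: an alternative that is
  chosen from the larger assortment is also chosen from the smaller one, if it is on offer there.
  The value at \<open>M + 1\<close> is a dummy outside of all assortments, so that the path leaves its
  alternative in the last layer too.\<close>

definition choice_path :: "(nat \<Rightarrow> nat) \<Rightarrow> bool" where
  "choice_path \<pi> \<longleftrightarrow> \<pi> (Suc M) = Suc n \<and>
     (\<forall>m\<in>{1..M}. \<pi> m \<in> S m \<and> (\<pi> (Suc m) \<in> S m \<longrightarrow> \<pi> (Suc m) = \<pi> m))"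

text \<open>Choice probabilities (of total mass \<open>w\<close>) satisfying the only constraint that nestedness
  imposes on them: adding alternatives to the assortment does not increase the demand for the old
  ones. With the convention for \<open>M + 1\<close>, the slacks \<open>p m i - p (m + 1) i\<close> account for all mass,
  and their being nonnegative makes the masses nonnegative.\<close>

definition mass_profile :: "real \<Rightarrow> (nat \<Rightarrow> nat \<Rightarrow> real) \<Rightarrow> bool" where
  "mass_profile w p \<longleftrightarrow>
     (\<forall>m\<in>{1..M}. (\<Sum>i\<in>S m. p m i) = w) \<and>
     (\<forall>(m, i)\<in>cells. p (Suc m) i \<le> p m i) \<and>
     (\<forall>i\<in>S M. p (Suc M) i = 0)"

lemma choice_path_stays:
  assumes \<pi>: "choice_path \<pi>" and "l \<le> m" "1 \<le> l" "m \<le> M" "\<pi> m \<in> S l"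
  shows "\<pi> l = \<pi> m"
  using assms(2-)
proof (induction l rule: inc_induct)
  case (step l)
  have "S l \<subseteq> S (Suc l)" using step S_step[of l] by auto
  then have "\<pi> (Suc l) = \<pi> m" using step by auto
  then show ?case using \<pi> step by (auto simp: choice_path_def)
qed simp

lemma mass_profile_nonneg:
  assumes p: "mass_profile w p" and "1 \<le> m" "m \<le> M" "i \<in> S m"
  shows "0 \<le> p m i"
proof -
  have "i \<in> S l \<longrightarrow> 0 \<le> p l i" if "1 \<le> l" "l \<le> M" for l
    using that(2,1)
  proof (induction l rule: inc_induct)
    case base
    then show ?case using p M_pos by (force simp: mass_profile_def)
  next
    case (step l)
    then have "i \<in> S l \<Longrightarrow> p (Suc l) i \<le> p l i" using p by (force simp: mass_profile_def)
    then show ?case using step S_step[of l] by force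
  qed
  then show ?thesis using assms by blast
qed

text \<open>A path along which mass can be removed is built from the last layer downwards. The path has
  to stay at an alternative as long as this is on offer; once it is not, the others carry strictly
  less than the total mass in the layer above, so one of them has a positive slack.\<close>

lemma ex_positive_path:
  assumes p: "mass_profile w p" and w: "0 < w"
  shows "\<exists>\<pi>. choice_path \<pi> \<and> (\<forall>m\<in>{1..M}. 0 < p m (\<pi> m) \<and>
    (\<pi> (Suc m) \<noteq> \<pi> m \<longrightarrow> p (Suc m) (\<pi> m) < p m (\<pi> m)))"
proof -
  define Q where "Q \<pi> l \<longleftrightarrow> \<pi> l \<in> S l \<and> (\<pi> (Suc l) \<in> S l \<longrightarrow> \<pi> (Suc l) = \<pi> l) \<and>
    (\<pi> (Suc l) \<noteq> \<pi> l \<longrightarrow> p (Suc l) (\<pi> l) < p l (\<pi> l)) \<and> 0 < p l (\<pi> l)"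
    for \<pi> :: "nat \<Rightarrow> nat" and l
  have mono: "p (Suc m) i \<le> p m i" if "1 \<le> m" "m \<le> M" "i \<in> S m" for m i
    using p that by (auto simp: mass_profile_def)
  have total: "(\<Sum>i\<in>S m. p m i) = w" if "1 \<le> m" "m \<le> M" for m
    using p that by (auto simp: mass_profile_def)
  have last: "p (Suc M) i = 0" if "i \<in> S M" for i using p that by (auto simp: mass_profile_def)
  have "\<exists>\<pi>. \<pi> (Suc M) = Suc n \<and> (\<forall>l\<in>{m..M}. Q \<pi> l)" if "m \<le> Suc M" "1 \<le> m" for m
    using that
  proof (induction m rule: inc_induct)
    case base
    show ?case by (intro exI[of _ "\<lambda>_. Suc n"]) simp
  next
    case (step m)
    then have m: "1 \<le> m" "m \<le> M" by auto
    from step obtain \<pi> where \<pi>: "\<pi> (Suc M) = Suc n" "\<forall>l\<in>{Suc m..M}. Q \<pi> l" by auto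
    have "\<exists>i\<in>S m. (\<pi> (Suc m) \<in> S m \<longrightarrow> \<pi> (Suc m) = i) \<and>
      (\<pi> (Suc m) \<noteq> i \<longrightarrow> p (Suc m) i < p m i) \<and> 0 < p m i"
    proof (cases "\<pi> (Suc m) \<in> S m")
      case True
      then have "m \<noteq> M" using \<pi>(1) S_subset[of M] M_pos by auto
      then have "0 < p (Suc m) (\<pi> (Suc m))" using \<pi>(2) m by (auto simp: Q_def)
      then show ?thesis using True mono[OF m True] by (auto intro: bexI[of _ "\<pi> (Suc m)"])
    next
      case False
      have "(\<Sum>i\<in>S m. p (Suc m) i) < w"
      proof (cases "m = M")
        case True
        then show ?thesis using last w by simp
      next
        case neq: False
        let ?a = "\<pi> (Suc m)"
        have a: "?a \<in> S (Suc m)" "0 < p (Suc m) ?a" using \<pi>(2) m neq by (auto simp: Q_def)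
        have "(\<Sum>i\<in>insert ?a (S m). p (Suc m) i) \<le> (\<Sum>i\<in>S (Suc m). p (Suc m) i)"
          using a m neq S_step[of m] mass_profile_nonneg[OF p]
          by (intro sum_mono2) (auto intro: finite_S)
        then show ?thesis using a False total[of "Suc m"] m neq finite_S[of m] by simp
      qed
      then have "\<not> (\<forall>i\<in>S m. p m i \<le> p (Suc m) i)"
        using sum_mono[of "S m" "p m" "p (Suc m)"] total[OF m] by auto
      then obtain i where i: "i \<in> S m" "p (Suc m) i < p m i" by (auto simp: not_le)
      have "0 \<le> p (Suc m) i"
        using i(1) m last S_step[of m] mass_profile_nonneg[OF p, of "Suc m" i]
        by (cases "m = M") auto
      then show ?thesis using i False by (intro bexI[of _ i]) auto
    qed
    then obtain i where i: "i \<in> S m" "\<pi> (Suc m) \<in> S m \<longrightarrow> \<pi> (Suc m) = i"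
      "\<pi> (Suc m) \<noteq> i \<longrightarrow> p (Suc m) i < p m i" "0 < p m i" by blast
    have "Q (\<pi>(m := i)) l" if "l \<in> {m..M}" for l
    proof (cases "l = m")
      case True
      then show ?thesis using i by (simp add: Q_def)
    next
      case False
      then show ?thesis using \<pi>(2)[rule_format, of l] that by (simp add: Q_def)
    qed
    then have "\<forall>l\<in>{m..M}. Q (\<pi>(m := i)) l" by blast
    moreover have "(\<pi>(m := i)) (Suc M) = Suc n" using \<pi>(1) m by simp
    ultimately show ?case by blast
  qed
  from this[of 1] obtain \<pi> where \<pi>: "\<pi> (Suc M) = Suc n" "\<forall>l\<in>{1..M}. Q \<pi> l" by auto
  then show ?thesis by (intro exI[of _ \<pi>]) (auto simp: choice_path_def Q_def)
qed

text \<open>A choice path together with the choice \<open>k\<close> from a new assortment \<open>T\<close> is consistent as soon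
  as, whenever \<open>k\<close> was on offer in the past, the past choice is \<open>k\<close> itself or not in \<open>T\<close>. The
  witness ranks the choices from the past assortments that contain \<open>k\<close> first, larger assortments
  before smaller ones, followed by \<open>k\<close> and then by the choices from the assortments without
  \<open>k\<close>.\<close>

lemma ranking_of_choice_path:
  assumes \<pi>: "choice_path \<pi>" and T: "T \<subseteq> {0..n}" "k \<in> T"
    and compat: "\<And>m. m \<in> {1..M} \<Longrightarrow> k \<in> S m \<Longrightarrow> \<pi> m \<in> T \<Longrightarrow> \<pi> m = k"
  shows "\<exists>\<sigma>\<in>rankings n. arg_min_on \<sigma> T = k \<and> (\<forall>m\<in>{1..M}. arg_min_on \<sigma> (S m) = \<pi> m)"
proof -
  \<comment> \<open>The first layer in which \<open>k\<close> is on offer, or \<open>M + 1\<close> if there is none.\<close>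
  define a where "a = (LEAST l. 1 \<le> l \<and> (l \<le> M \<longrightarrow> k \<in> S l))"
  have ex: "1 \<le> Suc M \<and> (Suc M \<le> M \<longrightarrow> k \<in> S (Suc M))" by simp
  have a: "1 \<le> a" "a \<le> M \<Longrightarrow> k \<in> S a" "a \<le> Suc M"
    unfolding a_def
    using LeastI[of "\<lambda>l. 1 \<le> l \<and> (l \<le> M \<longrightarrow> k \<in> S l)", OF ex]
      Least_le[of "\<lambda>l. 1 \<le> l \<and> (l \<le> M \<longrightarrow> k \<in> S l)", OF ex]
    by auto
  have below_a: "k \<notin> S m" if "1 \<le> m" "m \<le> M" "m < a" for m
    using not_less_Least[of m "\<lambda>l. 1 \<le> l \<and> (l \<le> M \<longrightarrow> k \<in> S l)"] that by (auto simp: a_def)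
  have above_a: "k \<in> S m" if "a \<le> m" "m \<le> M" for m
    using a that S_mono[of a m] by auto
  have \<pi>_in: "\<pi> m \<in> S m" if "1 \<le> m" "m \<le> M" for m using \<pi> that by (auto simp: choice_path_def)
  have stays: "\<pi> l = \<pi> m" if "1 \<le> l" "l \<le> m" "m \<le> M" "\<pi> m \<in> S l" for l m
    using choice_path_stays[OF \<pi>] that by blast
  define hi where "hi = map \<pi> (rev [a..<Suc M])"
  define lo where "lo = map \<pi> (rev [1..<a])"
  have "set (hi @ k # lo) \<subseteq> {0..n}"
  proof -
    have "\<pi> m \<in> {0..n}" if "1 \<le> m" "m \<le> M" for m using \<pi>_in[OF that] S_subset[of m] that by auto
    then show ?thesis using a T unfolding hi_def lo_def by auto
  qed
  then obtain \<sigma> where \<sigma>: "\<sigma> \<in> rankings n" and choice: "\<And>A ys x zs.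
    hi @ k # lo = ys @ x # zs \<Longrightarrow> x \<in> A \<Longrightarrow> set ys \<inter> A \<subseteq> {x} \<Longrightarrow> arg_min_on \<sigma> A = x"
    using ranking_of_list[of "hi @ k # lo"] by meson
  have "arg_min_on \<sigma> T = k"
  proof (rule choice[of hi k lo])
    show "set hi \<inter> T \<subseteq> {k}" using compat above_a a(1) by (auto simp: hi_def)
  qed (use T in simp_all)
  moreover have "arg_min_on \<sigma> (S m) = \<pi> m" if m: "m \<in> {1..M}" for m
  proof -
    have eq: "\<pi> l = \<pi> m" if "\<pi> l \<in> S m" "m \<le> l" "l \<le> M" for l
      using stays[of m l] m that by simp
    show ?thesis
    proof (cases "a \<le> m")
      case True
      have "[a..<Suc M] = [a..<m] @ m # [Suc m..<Suc M]"
        using True m upt_add_eq_append[of a m "Suc M - m"] upt_conv_Cons[of m "Suc M"] by auto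
      then have "hi @ k # lo = map \<pi> (rev [Suc m..<Suc M]) @ \<pi> m # (map \<pi> (rev [a..<m]) @ k # lo)"
        by (simp add: hi_def)
      then show ?thesis
      proof (rule choice)
        show "set (map \<pi> (rev [Suc m..<Suc M])) \<inter> S m \<subseteq> {\<pi> m}"
          by (auto intro!: eq)
      qed (use m \<pi>_in in simp)
    next
      case False
      have "[1..<a] = [1..<m] @ m # [Suc m..<a]"
        using False m upt_add_eq_append[of 1 m "a - m"] upt_conv_Cons[of m a] by auto
      then have "hi @ k # lo = (hi @ k # map \<pi> (rev [Suc m..<a])) @ \<pi> m # map \<pi> (rev [1..<m])"
        by (simp add: lo_def)
      then show ?thesis
      proof (rule choice)
        have "k \<notin> S m" using below_a m False by simp
        then show "set (hi @ k # map \<pi> (rev [Suc m..<a])) \<inter> S m \<subseteq> {\<pi> m}"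
          using False a unfolding hi_def by (auto intro!: eq)
      qed (use m \<pi>_in in simp)
    qed
  qed
  ultimately show ?thesis using \<sigma> by blast
qed

text \<open>Realizability is preserved under sums, so that a profile can be realized path by path.\<close>

definition realizable :: "nat set \<Rightarrow> nat \<Rightarrow> (nat \<Rightarrow> nat \<Rightarrow> real) \<Rightarrow> bool" where
  "realizable T k p \<longleftrightarrow> (\<exists>\<mu>.
     (\<forall>\<sigma>\<in>rankings n. 0 \<le> \<mu> \<sigma> \<and> (\<mu> \<sigma> \<noteq> 0 \<longrightarrow> arg_min_on \<sigma> T = k)) \<and>
     (\<forall>(m, i)\<in>cells. demand n \<mu> i (S m) = p m i))"

text \<open>Removing from a profile as much mass as possible along a positive path makes one more slack
  vanish and no slack reappear, so a profile is a finite combination of paths, each of which is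
  realized by a single ranking.\<close>

lemma mass_profile_realizable:
  assumes T: "T \<subseteq> {0..n}"
    and p: "mass_profile w p" "0 \<le> w" "0 < w \<Longrightarrow> k \<in> T"
    and compat: "\<And>m j. (m, j) \<in> cells \<Longrightarrow> k \<in> S m \<Longrightarrow> j \<in> T \<Longrightarrow> j \<noteq> k \<Longrightarrow> p m j = 0"
  shows "realizable T k p"
  using p compat
proof (induction "card {(m, i) \<in> cells. p (Suc m) i \<noteq> p m i}" arbitrary: p w rule: less_induct)
  case less
  note p = less.prems(1)
  have nonneg: "0 \<le> p m i" if "(m, i) \<in> cells" for m i
    using mass_profile_nonneg[OF p] that by auto
  show ?case
  proof (cases "w = 0")
    case True
    have "p m i = 0" if mi: "(m, i) \<in> cells" for m i
    proof -
      have "(\<Sum>i\<in>S m. p m i) = 0" using p mi True by (auto simp: mass_profile_def)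
      then show ?thesis using nonneg mi finite_S[of m] by (auto simp: sum_nonneg_eq_0_iff)
    qed
    then show ?thesis unfolding realizable_def
      by (intro exI[of _ "\<lambda>_. 0"]) (auto simp: demand_def)
  next
    case False
    then obtain \<pi> where \<pi>: "choice_path \<pi>" and pos: "\<And>m. m \<in> {1..M} \<Longrightarrow> 0 < p m (\<pi> m)"
      and slack: "\<And>m. m \<in> {1..M} \<Longrightarrow> \<pi> (Suc m) \<noteq> \<pi> m \<Longrightarrow> p (Suc m) (\<pi> m) < p m (\<pi> m)"
      using ex_positive_path[OF p] less.prems(2) by force
    have \<pi>_in: "\<pi> m \<in> S m" if "m \<in> {1..M}" for m using \<pi> that by (auto simp: choice_path_def)
    have \<pi>_M: "\<pi> (Suc M) \<notin> S M" using \<pi> S_subset[of M] M_pos by (auto simp: choice_path_def)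
    define L where "L = {m \<in> {1..M}. \<pi> (Suc m) \<noteq> \<pi> m}"
    define s where "s m = p m (\<pi> m) - p (Suc m) (\<pi> m)" for m
    define \<delta> where "\<delta> = Min (s ` L)"
    have L: "finite (s ` L)" "s ` L \<noteq> {}"
      using \<pi>_M \<pi>_in[of M] M_pos by (auto simp: L_def)
    then have "\<delta> \<in> s ` L" unfolding \<delta>_def by (rule Min_in)
    then obtain l where l: "l \<in> {1..M}" "\<pi> (Suc l) \<noteq> \<pi> l" "\<delta> = s l" by (auto simp: L_def)
    have \<delta>_le: "\<delta> \<le> s m" if "m \<in> {1..M}" "\<pi> (Suc m) \<noteq> \<pi> m" for m
      using L that unfolding \<delta>_def by (intro Min_le) (auto simp: L_def)
    have \<delta>: "0 < \<delta>" using slack[OF l(1,2)] l(3) by (simp add: s_def)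
    define q where "q m i = p m i - \<delta> * of_bool (\<pi> m = i)" for m i
    \<comment> \<open>A path loses slack only where it leaves an alternative: if it arrives at \<open>i \<in> S m\<close> in layer
      \<open>m + 1\<close>, it was at \<open>i\<close> in layer \<open>m\<close> already.\<close>
    have slack_q: "q m i - q (Suc m) i = p m i - p (Suc m) i -
        (if \<pi> m = i \<and> \<pi> (Suc m) \<noteq> \<pi> m then \<delta> else 0)" if "(m, i) \<in> cells" for m i
      using that \<pi> by (auto simp: q_def choice_path_def)
    have q: "mass_profile (w - \<delta>) q"
      unfolding mass_profile_def
    proof (intro conjI ballI)
      fix m assume m: "m \<in> {1..M}"
      have "(\<Sum>i\<in>S m. \<delta> * of_bool (\<pi> m = i)) = \<delta>"
        using \<pi>_in[OF m] finite_S[OF m] by (simp add: of_bool_def sum.delta flip: sum_distrib_left)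
      then show "(\<Sum>i\<in>S m. q m i) = w - \<delta>"
        using p m by (simp add: q_def sum_subtractf mass_profile_def)
    next
      fix c assume "c \<in> cells"
      moreover obtain m i where c: "c = (m, i)" by fastforce
      ultimately have mi: "(m, i) \<in> cells" by simp
      moreover have "p (Suc m) i \<le> p m i" using p mi by (auto simp: mass_profile_def)
      ultimately show "case c of (m, i) \<Rightarrow> q (Suc m) i \<le> q m i"
        using slack_q[OF mi] \<delta>_le[of m] c by (auto simp: s_def split: if_splits)
    next
      fix i assume "i \<in> S M"
      then show "q (Suc M) i = 0" using p \<pi>_M by (auto simp: q_def mass_profile_def)
    qed
    have q_mass: "0 \<le> w - \<delta>"
    proof -
      have "0 \<le> (\<Sum>i\<in>S 1. q 1 i)" using mass_profile_nonneg[OF q] M_pos by (intro sum_nonneg) auto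
      then show ?thesis using q M_pos by (simp add: mass_profile_def)
    qed
    have compat_\<pi>: "\<pi> m = k" if "m \<in> {1..M}" "k \<in> S m" "\<pi> m \<in> T" for m
      using less.prems(4)[of m "\<pi> m"] pos[of m] \<pi>_in[of m] that by force
    have compat_q: "q m j = 0" if "(m, j) \<in> cells" "k \<in> S m" "j \<in> T" "j \<noteq> k" for m j
      using less.prems(4)[OF that] compat_\<pi>[of m] that by (auto simp: q_def)
    have "{(m, i) \<in> cells. q (Suc m) i \<noteq> q m i} \<subset> {(m, i) \<in> cells. p (Suc m) i \<noteq> p m i}"
    proof
      show "{(m, i) \<in> cells. q (Suc m) i \<noteq> q m i} \<subseteq> {(m, i) \<in> cells. p (Suc m) i \<noteq> p m i}"
        using slack_q slack by (force split: if_splits)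
      show "{(m, i) \<in> cells. q (Suc m) i \<noteq> q m i} \<noteq> {(m, i) \<in> cells. p (Suc m) i \<noteq> p m i}"
      proof -
        have "(l, \<pi> l) \<in> cells" using l(1) \<pi>_in by auto
        moreover have "q (Suc l) (\<pi> l) = q l (\<pi> l)"
          using slack_q[OF calculation] l by (simp add: s_def)
        moreover have "p (Suc l) (\<pi> l) \<noteq> p l (\<pi> l)" using slack[OF l(1,2)] by simp
        ultimately show ?thesis by blast
      qed
    qed
    then have "card {(m, i) \<in> cells. q (Suc m) i \<noteq> q m i}
        < card {(m, i) \<in> cells. p (Suc m) i \<noteq> p m i}"
      by (intro psubset_card_mono) (auto intro: finite_subset[OF _ finite_cells])
    moreover have k: "k \<in> T" using less.prems(2,3) False by simp
    ultimately have "realizable T k q" by (rule less.hyps[OF _ q q_mass _ compat_q])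
    then obtain \<mu> where \<mu>: "\<And>\<sigma>. \<sigma> \<in> rankings n \<Longrightarrow> 0 \<le> \<mu> \<sigma> \<and> (\<mu> \<sigma> \<noteq> 0 \<longrightarrow> arg_min_on \<sigma> T = k)"
      and dem: "\<And>m i. (m, i) \<in> cells \<Longrightarrow> demand n \<mu> i (S m) = q m i"
      unfolding realizable_def by fast
    obtain \<sigma> where \<sigma>: "\<sigma> \<in> rankings n" "arg_min_on \<sigma> T = k"
      "\<And>m. m \<in> {1..M} \<Longrightarrow> arg_min_on \<sigma> (S m) = \<pi> m"
      using ranking_of_choice_path[OF \<pi> T k compat_\<pi>] by blast
    show ?thesis unfolding realizable_def
    proof (intro exI[of _ "\<lambda>\<tau>. \<mu> \<tau> + \<delta> * of_bool (\<tau> = \<sigma>)"] conjI ballI)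
      fix \<tau> assume "\<tau> \<in> rankings n"
      then show "0 \<le> \<mu> \<tau> + \<delta> * of_bool (\<tau> = \<sigma>)" using \<mu>[of \<tau>] \<delta> by simp
      show "\<mu> \<tau> + \<delta> * of_bool (\<tau> = \<sigma>) \<noteq> 0 \<longrightarrow> arg_min_on \<tau> T = k"
        using \<mu>[of \<tau>] \<sigma> \<open>\<tau> \<in> rankings n\<close> by auto
    next
      fix c assume "c \<in> cells"
      then show "case c of (m, i) \<Rightarrow>
          demand n (\<lambda>\<tau>. \<mu> \<tau> + \<delta> * of_bool (\<tau> = \<sigma>)) i (S m) = p m i"
        using \<sigma> by (auto simp: demand_add demand_point dem q_def)
    qed
  qed
qed
end

section \<open>Assembling mixed-integer linear problems from affine expressions\<close>

lemma sum_of_bool_eq_mult: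
  assumes "finite A" "j \<in> A"
  shows "(\<Sum>i\<in>A. of_bool (i = j) * f i) = (f j :: real)"
proof -
  have "(\<Sum>i\<in>A. of_bool (i = j) * f i) = (\<Sum>i\<in>A. if i = j then f j else 0)"
    by (intro sum.cong) auto
  then show ?thesis using assms by simp
qed

lemma affine_const: "affine_in_data n M (\<lambda>_. c)"
  unfolding affine_in_data_def
  by (intro exI[of _ c] exI[of _ "\<lambda>_. 0"] exI[of _ "\<lambda>_ _. 0"] exI[of _ 0]) simp

lemma affine_add:
  assumes "affine_in_data n M f" "affine_in_data n M g"
  shows "affine_in_data n M (\<lambda>D. f D + g D)"
proof -
  obtain c1 a1 b1 g1 where 1: "\<And>r v \<eta>. f (r, v, \<eta>) = c1 + (\<Sum>i\<in>{0..n}. a1 i * r i) +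
      (\<Sum>m\<in>{1..M}. \<Sum>i\<in>{0..n}. b1 m i * v m i) + g1 * \<eta>"
    using assms(1) unfolding affine_in_data_def by blast
  obtain c2 a2 b2 g2 where 2: "\<And>r v \<eta>. g (r, v, \<eta>) = c2 + (\<Sum>i\<in>{0..n}. a2 i * r i) +
      (\<Sum>m\<in>{1..M}. \<Sum>i\<in>{0..n}. b2 m i * v m i) + g2 * \<eta>"
    using assms(2) unfolding affine_in_data_def by blast
  show ?thesis unfolding affine_in_data_def
    by (intro exI[of _ "c1 + c2"] exI[of _ "\<lambda>i. a1 i + a2 i"] exI[of _ "\<lambda>m i. b1 m i + b2 m i"]
        exI[of _ "g1 + g2"]) (simp add: 1 2 distrib_right sum.distrib)
qed

lemma affine_uminus:
  assumes "affine_in_data n M f"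
  shows "affine_in_data n M (\<lambda>D. - f D)"
proof -
  obtain c a b g where "\<And>r v \<eta>. f (r, v, \<eta>) = c + (\<Sum>i\<in>{0..n}. a i * r i) +
      (\<Sum>m\<in>{1..M}. \<Sum>i\<in>{0..n}. b m i * v m i) + g * \<eta>"
    using assms unfolding affine_in_data_def by blast
  then show ?thesis unfolding affine_in_data_def
    by (intro exI[of _ "- c"] exI[of _ "\<lambda>i. - a i"] exI[of _ "\<lambda>m i. - b m i"] exI[of _ "- g"])
      (simp add: sum_negf)
qed

lemma affine_revenue: "k \<le> n \<Longrightarrow> affine_in_data n M (\<lambda>D. fst D k)"
  unfolding affine_in_data_def
  by (intro exI[of _ 0] exI[of _ "\<lambda>i. of_bool (i = k)"] exI[of _ "\<lambda>_ _. 0"] exI[of _ 0])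
    (simp add: sum_of_bool_eq_mult)

lemma affine_sales:
  assumes "m \<in> {1..M}" "i \<le> n"
  shows "affine_in_data n M (\<lambda>D. fst (snd D) m i)"
proof -
  have "(\<Sum>m'\<in>{1..M}. \<Sum>i'\<in>{0..n}. of_bool (m' = m \<and> i' = i) * v m' i') = v m i"
    for v :: "nat \<Rightarrow> nat \<Rightarrow> real"
  proof -
    have "(\<Sum>i'\<in>{0..n}. of_bool (m' = m \<and> i' = i) * v m' i') = (if m' = m then v m i else 0)" for m'
    proof -
      have "(\<Sum>i'\<in>{0..n}. of_bool (m' = m \<and> i' = i) * v m' i')
        = (\<Sum>i'\<in>{0..n}. if i' = i then (if m' = m then v m i else 0) else 0)"
        by (intro sum.cong) auto
      then show ?thesis using assms(2) by simp
    qed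
    then have "(\<Sum>m'\<in>{1..M}. \<Sum>i'\<in>{0..n}. of_bool (m' = m \<and> i' = i) * v m' i')
      = (\<Sum>m'\<in>{1..M}. if m' = m then v m i else 0)"
      by (intro sum.cong) auto
    then show ?thesis using assms(1) by simp
  qed
  then show ?thesis unfolding affine_in_data_def
    by (intro exI[of _ 0] exI[of _ "\<lambda>_. 0"] exI[of _ "\<lambda>m' i'. of_bool (m' = m \<and> i' = i)"]
        exI[of _ 0]) simp
qed

lemma affine_radius: "affine_in_data n M (\<lambda>D. snd (snd D))"
  unfolding affine_in_data_def
  by (intro exI[of _ 0] exI[of _ "\<lambda>_. 0"] exI[of _ "\<lambda>_ _. 0"] exI[of _ 1]) simp

text \<open>Expressions in the data, the binary variables and continuous variables that are named by the
  members of an arbitrary set; a constraint demands such an expression to be nonpositive. Data only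
  enter the constant term; the revenues, which multiply variables, occur in the objective alone.\<close>

type_synonym 'v expr = "num_data \<Rightarrow> (nat \<Rightarrow> real) \<Rightarrow> ('v \<Rightarrow> real) \<Rightarrow> real"

definition affine_expr :: "nat \<Rightarrow> nat \<Rightarrow> 'v set \<Rightarrow> 'v expr \<Rightarrow> bool" where
  "affine_expr n M V e \<longleftrightarrow> (\<exists>a b c. affine_in_data n M c \<and>
     (\<forall>D x y. e D x y = (\<Sum>j\<in>{1..n}. a j * x j) + (\<Sum>v\<in>V. b v * y v) + c D))"

lemma affine_expr_data: "affine_in_data n M c \<Longrightarrow> affine_expr n M V (\<lambda>D x y. c D)"
  unfolding affine_expr_def by (intro exI[of _ "\<lambda>_. 0"] exI[of _ c]) simp

lemma affine_expr_bin:
  assumes "j \<in> {1..n}"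
  shows "affine_expr n M V (\<lambda>D x y. x j)"
proof -
  have "(\<Sum>i\<in>{1..n}. of_bool (i = j) * x i) = x j" for x :: "nat \<Rightarrow> real"
    using assms by (intro sum_of_bool_eq_mult) auto
  then show ?thesis unfolding affine_expr_def
    by (intro exI[of _ "\<lambda>i. of_bool (i = j)"] exI[of _ "\<lambda>_. 0"] exI[of _ "\<lambda>_ :: num_data. 0"])
      (simp add: affine_const)
qed

lemma affine_expr_cont:
  assumes "finite V" "u \<in> V"
  shows "affine_expr n M V (\<lambda>D x y. y u)"
proof -
  have "(\<Sum>v\<in>V. of_bool (v = u) * y v) = y u" for y :: "'a \<Rightarrow> real"
    using assms by (intro sum_of_bool_eq_mult) auto
  then show ?thesis unfolding affine_expr_def
    by (intro exI[of _ "\<lambda>_. 0"] exI[of _ "\<lambda>v. of_bool (v = u)"] exI[of _ "\<lambda>_ :: num_data. 0"])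
      (simp add: affine_const)
qed

lemma affine_expr_add:
  assumes "affine_expr n M V e" "affine_expr n M V f"
  shows "affine_expr n M V (\<lambda>D x y. e D x y + f D x y)"
proof -
  obtain a1 b1 c1 where 1: "affine_in_data n M c1"
    "\<And>D x y. e D x y = (\<Sum>j\<in>{1..n}. a1 j * x j) + (\<Sum>v\<in>V. b1 v * y v) + c1 D"
    using assms(1) unfolding affine_expr_def by blast
  obtain a2 b2 c2 where 2: "affine_in_data n M c2"
    "\<And>D x y. f D x y = (\<Sum>j\<in>{1..n}. a2 j * x j) + (\<Sum>v\<in>V. b2 v * y v) + c2 D"
    using assms(2) unfolding affine_expr_def by blast
  show ?thesis unfolding affine_expr_def
    by (intro exI[of _ "\<lambda>j. a1 j + a2 j"] exI[of _ "\<lambda>v. b1 v + b2 v"] exI[of _ "\<lambda>D. c1 D + c2 D"])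
      (simp add: 1 2 affine_add distrib_right sum.distrib)
qed

lemma affine_expr_uminus:
  assumes "affine_expr n M V e"
  shows "affine_expr n M V (\<lambda>D x y. - e D x y)"
proof -
  obtain a b c where "affine_in_data n M c"
    "\<And>D x y. e D x y = (\<Sum>j\<in>{1..n}. a j * x j) + (\<Sum>v\<in>V. b v * y v) + c D"
    using assms unfolding affine_expr_def by blast
  then show ?thesis unfolding affine_expr_def
    by (intro exI[of _ "\<lambda>j. - a j"] exI[of _ "\<lambda>v. - b v"] exI[of _ "\<lambda>D. - c D"])
      (simp add: affine_uminus sum_negf)
qed

lemma affine_expr_diff:
  assumes "affine_expr n M V e" "affine_expr n M V f"
  shows "affine_expr n M V (\<lambda>D x y. e D x y - f D x y)"
  using affine_expr_add[OF assms(1) affine_expr_uminus[OF assms(2)]] by simp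

lemma affine_expr_sum:
  assumes "finite I" "\<And>i. i \<in> I \<Longrightarrow> affine_expr n M V (e i)"
  shows "affine_expr n M V (\<lambda>D x y. \<Sum>i\<in>I. e i D x y)"
  using assms
proof (induction I rule: finite_induct)
  case empty
  then show ?case by (simp add: affine_expr_data affine_const)
next
  case (insert i I)
  then show ?case by (simp add: affine_expr_add)
qed

text \<open>Named variables and a set of constraints are turned into a problem with numbered columns and
  rows by choosing enumerations of both sets.\<close>

lemma ex_milp_template:
  fixes V :: "'v set" and E :: "'v expr set"
  assumes V: "finite V" and E: "finite E" "\<And>e. e \<in> E \<Longrightarrow> affine_expr n M V e"
    and cost: "\<And>u. u \<in> V \<Longrightarrow> affine_in_data n M (\<lambda>D. cost D u)"
  shows "\<exists>F. milp_template n M n (card V) (card E) F \<and>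
    (\<forall>D. nbin (F D) = n \<and>
      (\<forall>x z. (\<exists>y. (x, y) \<in> milp_feasible (F D) \<and> milp_objective (F D) (x, y) = z) \<longleftrightarrow>
        (\<forall>j\<in>{1..n}. x j \<in> {0, 1}) \<and>
        (\<exists>y. (\<forall>e\<in>E. e D x y \<le> 0) \<and> (\<Sum>u\<in>V. cost D u * y u) = z)))"
proof -
  define R where "R e a b c \<longleftrightarrow> affine_in_data n M c \<and>
      (\<forall>D x y. e D x y = (\<Sum>j\<in>{1..n}. a j * x j) + (\<Sum>v\<in>V. b v * y v) + c D)"
    for e :: "'v expr" and a b c
  have "\<forall>e\<in>E. \<exists>a b c. R e a b c" using E(2) unfolding affine_expr_def R_def by blast
  then obtain a b c where R: "\<And>e. e \<in> E \<Longrightarrow> R e (a e) (b e) (c e)" by metis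
  have c: "affine_in_data n M (c e)" if "e \<in> E" for e using R[OF that] by (simp add: R_def)
  have e: "e D x y = (\<Sum>j\<in>{1..n}. a e j * x j) + (\<Sum>v\<in>V. b e v * y v) + c e D"
    if "e \<in> E" for e D x y using R[OF that] unfolding R_def by blast
  obtain h where h: "bij_betw h {1..card V} V" using ex_bij_betw_nat_finite_1[OF V] by blast
  obtain g where g: "bij_betw g {1..card E} E" using ex_bij_betw_nat_finite_1[OF E(1)] by blast
  have h_in: "h j \<in> V" if "j \<in> {1..card V}" for j using h that by (auto simp: bij_betw_def)
  have g_in: "g l \<in> E" if "l \<in> {1..card E}" for l using g that by (auto simp: bij_betw_def)
  define F where "F D = \<lparr>nbin = n, ncont = card V, nrows = card E,
    cost_bin = (\<lambda>_. 0), cost_cont = (\<lambda>j. cost D (h j)),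
    coef_bin = (\<lambda>l. a (g l)), coef_cont = (\<lambda>l j. b (g l) (h j)), rhs = (\<lambda>l. - c (g l) D)\<rparr>" for D
  have template: "milp_template n M n (card V) (card E) F"
    unfolding milp_template_def F_def
    using affine_const cost[OF h_in] affine_uminus[OF c[OF g_in]] by auto
  have sum_h: "(\<Sum>j\<in>{1..card V}. f (h j)) = (\<Sum>v\<in>V. f v)" for f :: "'v \<Rightarrow> real"
    by (rule sum.reindex_bij_betw[OF h])
  have rows: "(x, y \<circ> h) \<in> milp_feasible (F D) \<longleftrightarrow>
      (\<forall>j\<in>{1..n}. x j \<in> {0, 1}) \<and> (\<forall>e\<in>E. e D x y \<le> 0)" for D x y
  proof -
    have "(\<forall>l\<in>{1..card E}. (\<Sum>j\<in>{1..n}. a (g l) j * x j) +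
        (\<Sum>j\<in>{1..card V}. b (g l) (h j) * y (h j)) \<le> - c (g l) D) \<longleftrightarrow>
      (\<forall>l\<in>{1..card E}. g l D x y \<le> 0)"
    proof (intro ball_cong refl)
      fix l assume "l \<in> {1..card E}"
      then have "g l D x y = (\<Sum>j\<in>{1..n}. a (g l) j * x j) +
          (\<Sum>j\<in>{1..card V}. b (g l) (h j) * y (h j)) + c (g l) D"
        using sum_h[of "\<lambda>v. b (g l) v * y v"] by (simp only: e[OF g_in])
      then show "(\<Sum>j\<in>{1..n}. a (g l) j * x j) +
          (\<Sum>j\<in>{1..card V}. b (g l) (h j) * y (h j)) \<le> - c (g l) D \<longleftrightarrow> g l D x y \<le> 0"
        by linarith
    qed
    also have "\<dots> \<longleftrightarrow> (\<forall>e\<in>E. e D x y \<le> 0)"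
      using ball_simps(9)[of g "{1..card E}"] by (simp only: bij_betw_imp_surj_on[OF g])
    finally show ?thesis by (simp add: milp_feasible_def F_def)
  qed
  have obj: "milp_objective (F D) (x, y \<circ> h) = (\<Sum>u\<in>V. cost D u * y u)" for D x y
    using sum_h[of "\<lambda>u. cost D u * y u"] by (simp add: milp_objective_def F_def)
  define name where "name y = y \<circ> inv_into {1..card V} h" for y :: "nat \<Rightarrow> real"
  have "(name y \<circ> h) j = y j" if "j \<in> {1..card V}" for y j
    using bij_betw_inv_into_left[OF h that] by (simp add: name_def)
  then have named: "(x, name y \<circ> h) \<in> milp_feasible (F D) \<longleftrightarrow> (x, y) \<in> milp_feasible (F D)"
    "milp_objective (F D) (x, name y \<circ> h) = milp_objective (F D) (x, y)" for D x y
    by (simp_all add: milp_feasible_def milp_objective_def F_def)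
  have "(\<exists>y. (x, y) \<in> milp_feasible (F D) \<and> milp_objective (F D) (x, y) = z) \<longleftrightarrow>
        (\<forall>j\<in>{1..n}. x j \<in> {0, 1}) \<and>
        (\<exists>y. (\<forall>e\<in>E. e D x y \<le> 0) \<and> (\<Sum>u\<in>V. cost D u * y u) = z)" (is "?L \<longleftrightarrow> ?R") for D x z
  proof
    assume ?L
    then obtain y where "(x, y) \<in> milp_feasible (F D)" "milp_objective (F D) (x, y) = z" by blast
    then have "(x, name y \<circ> h) \<in> milp_feasible (F D)" "milp_objective (F D) (x, name y \<circ> h) = z"
      by (simp_all add: named)
    then show ?R unfolding rows obj by blast
  next
    assume ?R
    then obtain y where "(x, y \<circ> h) \<in> milp_feasible (F D)" "milp_objective (F D) (x, y \<circ> h) = z"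
      unfolding rows obj by blast
    then show ?L by blast
  qed
  moreover have "nbin (F D) = n" for D by (simp add: F_def)
  ultimately show ?thesis using template by blast
qed

section \<open>The mixed-integer linear problem\<close>

text \<open>\<open>Mass k\<close> is the probability that \<open>k\<close> is chosen from the new assortment, \<open>Flow k m i\<close> the
  probability that moreover \<open>i\<close> is chosen from \<open>S m\<close>, and \<open>Dev m i\<close> bounds the deviation of the
  demand from the sales data.\<close>

datatype var = Mass nat | Flow nat nat nat | Dev nat nat

text \<open>The no-purchase option has no binary variable, being on offer in every assortment.\<close>

definition offered :: "(nat \<Rightarrow> real) \<Rightarrow> nat \<Rightarrow> real" where
  "offered x j = (if j = 0 then 1 else x j)"

lemma affine_expr_offered: "j \<le> n \<Longrightarrow> affine_expr n M V (\<lambda>D x y. offered x j)"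
  by (cases "j = 0") (simp_all add: offered_def affine_expr_data affine_const affine_expr_bin)

lemma card_image_le_bound:
  assumes "I \<subseteq> J" "finite J" "card J \<le> N"
  shows "card (f ` I) \<le> N"
  using assms card_image_le[of I f] card_mono[of J I] finite_subset[of I J] by linarith

context nested_assortments
begin

definition vars :: "var set" where
  "vars = Mass ` {0..n} \<union> (\<lambda>(k, m, i). Flow k m i) ` ({0..n} \<times> cells) \<union>
     (\<lambda>(m, i). Dev m i) ` cells"

definition norm_constraints :: "norm_kind \<Rightarrow> var expr set" where
  "norm_constraints nk = (case nk of
        L1 \<Rightarrow> {\<lambda>D x y. (\<Sum>c\<in>cells. y (Dev (fst c) (snd c))) - snd (snd D)}
      | Linf \<Rightarrow> (\<lambda>(m, i) D x y. y (Dev m i) - snd (snd D)) ` cells)"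

text \<open>For every \<open>k\<close>, the flows \<open>Flow k\<close> form a mass profile of total mass \<open>Mass k\<close>. If \<open>k\<close> was on
  offer in \<open>S m\<close>, a customer who now chooses \<open>k\<close> cannot have chosen another alternative \<open>j\<close> of
  the new assortment from \<open>S m\<close>; as flows are at most \<open>1\<close>, this is linear in the binary
  variables.\<close>

definition constraints :: "norm_kind \<Rightarrow> var expr set" where
  "constraints nk =
     (\<lambda>(k, m, i) D x y. - y (Flow k m i)) ` ({0..n} \<times> cells) \<union>
     (\<lambda>(k, m) D x y. (\<Sum>i\<in>S m. y (Flow k m i)) - y (Mass k)) ` ({0..n} \<times> {1..M}) \<union>
     (\<lambda>(k, m) D x y. y (Mass k) - (\<Sum>i\<in>S m. y (Flow k m i))) ` ({0..n} \<times> {1..M}) \<union>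
     (\<lambda>(k, m, i) D x y. y (Flow k (Suc m) i) - y (Flow k m i)) ` ({0..n} \<times> Sigma {1..<M} S) \<union>
     {\<lambda>D x y. (\<Sum>k\<in>{0..n}. y (Mass k)) - 1} \<union>
     {\<lambda>D x y. 1 - (\<Sum>k\<in>{0..n}. y (Mass k))} \<union>
     (\<lambda>k D x y. y (Mass k) - offered x k) ` {0..n} \<union>
     (\<lambda>(k, m, j) D x y. y (Flow k m j) - (1 - offered x j)) `
       {(k, m, j) \<in> {0..n} \<times> cells. k \<in> S m \<and> j \<noteq> k} \<union>
     (\<lambda>(m, i) D x y. (\<Sum>k\<in>{0..n}. y (Flow k m i)) - fst (snd D) m i - y (Dev m i)) ` cells \<union>
     (\<lambda>(m, i) D x y. fst (snd D) m i - (\<Sum>k\<in>{0..n}. y (Flow k m i)) - y (Dev m i)) ` cells \<union>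
     norm_constraints nk"

lemma constraints_iff:
  "(\<forall>e\<in>constraints nk. e (r, v, \<eta>) x y \<le> 0) \<longleftrightarrow>
     (\<forall>k\<in>{0..n}. \<forall>(m, i)\<in>cells. 0 \<le> y (Flow k m i)) \<and>
     (\<forall>k\<in>{0..n}. \<forall>m\<in>{1..M}. (\<Sum>i\<in>S m. y (Flow k m i)) = y (Mass k)) \<and>
     (\<forall>k\<in>{0..n}. \<forall>m\<in>{1..<M}. \<forall>i\<in>S m. y (Flow k (Suc m) i) \<le> y (Flow k m i)) \<and>
     (\<Sum>k\<in>{0..n}. y (Mass k)) = 1 \<and>
     (\<forall>k\<in>{0..n}. y (Mass k) \<le> offered x k) \<and>
     (\<forall>k\<in>{0..n}. \<forall>(m, j)\<in>cells. k \<in> S m \<longrightarrow> j \<noteq> k \<longrightarrow>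
        y (Flow k m j) \<le> 1 - offered x j) \<and>
     (\<forall>(m, i)\<in>cells. \<bar>(\<Sum>k\<in>{0..n}. y (Flow k m i)) - v m i\<bar> \<le> y (Dev m i)) \<and>
     (case nk of L1 \<Rightarrow> (\<Sum>(m, i)\<in>cells. y (Dev m i)) \<le> \<eta>
      | Linf \<Rightarrow> (\<forall>(m, i)\<in>cells. y (Dev m i) \<le> \<eta>))"
proof -
  let ?sat = "\<lambda>E. \<forall>e\<in>E. e (r, v, \<eta>) x y \<le> 0"
  have eq: "(\<forall>k\<in>{0..n}. \<forall>m\<in>{1..M}. (\<Sum>i\<in>S m. y (Flow k m i)) = y (Mass k)) \<longleftrightarrow>
    (\<forall>k\<in>{0..n}. \<forall>m\<in>{1..M}. (\<Sum>i\<in>S m. y (Flow k m i)) \<le> y (Mass k)) \<and>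
    (\<forall>k\<in>{0..n}. \<forall>m\<in>{1..M}. y (Mass k) \<le> (\<Sum>i\<in>S m. y (Flow k m i)))"
    unfolding order_eq_iff[where 'a = real] by blast
  have abs: "(\<forall>(m, i)\<in>cells. \<bar>(\<Sum>k\<in>{0..n}. y (Flow k m i)) - v m i\<bar> \<le> y (Dev m i)) \<longleftrightarrow>
    (\<forall>(m, i)\<in>cells. (\<Sum>k\<in>{0..n}. y (Flow k m i)) - v m i \<le> y (Dev m i)) \<and>
    (\<forall>(m, i)\<in>cells. v m i - (\<Sum>k\<in>{0..n}. y (Flow k m i)) \<le> y (Dev m i))"
    by (force simp: abs_le_iff)
  have nk: "?sat (norm_constraints nk) \<longleftrightarrow>
    (case nk of L1 \<Rightarrow> (\<Sum>(m, i)\<in>cells. y (Dev m i)) \<le> \<eta>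
      | Linf \<Rightarrow> (\<forall>(m, i)\<in>cells. y (Dev m i) \<le> \<eta>))"
    by (cases nk) (auto simp: norm_constraints_def case_prod_beta)
  show ?thesis
    unfolding eq abs constraints_def ball_Un order_eq_iff[of "\<Sum>k\<in>{0..n}. y (Mass k)" 1]
      conj_assoc
    by (intro arg_cong2[of _ _ _ _ "(\<and>)"] nk) auto
qed

lemma finite_vars: "finite vars"
  using finite_cells by (simp add: vars_def)

lemma finite_constraints: "finite (constraints nk)"
proof -
  have "finite (Sigma {1..<M} S)" by (rule finite_subset[OF _ finite_cells]) auto
  moreover have "finite {(k, m, j) \<in> {0..n} \<times> cells. k \<in> S m \<and> j \<noteq> k}"
    by (rule finite_subset[of _ "{0..n} \<times> cells"])
      (blast, intro finite_cartesian_product finite_atLeastAtMost finite_cells)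
  ultimately show ?thesis
    using finite_cells unfolding constraints_def norm_constraints_def by (cases nk) simp_all
qed

lemma affine_constraints:
  assumes "e \<in> constraints nk"
  shows "affine_expr n M vars e"
proof -
  have var [simp]: "affine_expr n M vars (\<lambda>D x y. y u)" if "u \<in> vars" for u
    by (rule affine_expr_cont[OF finite_vars that])
  have mass: "Mass k \<in> vars" if "k \<le> n" for k using that by (auto simp: vars_def)
  have flow: "Flow k m i \<in> vars" if "k \<le> n" "1 \<le> m" "m \<le> M" "i \<in> S m" for k m i
    using that by (force simp: vars_def)
  have dev: "Dev m i \<in> vars" if "1 \<le> m" "m \<le> M" "i \<in> S m" for m i
    using that by (force simp: vars_def)
  have flow_Suc: "Flow k (Suc m) i \<in> vars" if "k \<le> n" "1 \<le> m" "m < M" "i \<in> S m" for k m i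
    using that S_step[of m] by (intro flow) auto
  have offered: "affine_expr n M vars (\<lambda>D x y. offered x j)" if "1 \<le> m" "m \<le> M" "j \<in> S m" for m j
    using that S_subset[of m] by (intro affine_expr_offered) auto
  have sales: "affine_expr n M vars (\<lambda>D x y. fst (snd D) m i)" if "1 \<le> m" "m \<le> M" "i \<in> S m" for m i
    using that S_subset[of m] by (intro affine_expr_data affine_sales) auto
  have const: "affine_expr n M vars (\<lambda>D x y. c)" for c
    by (intro affine_expr_data affine_const)
  have radius: "affine_expr n M vars (\<lambda>D x y. snd (snd D))"
    by (intro affine_expr_data affine_radius)
  have fin: "finite (S m)" if "1 \<le> m" "m \<le> M" for m using that finite_S by simp
  note rules = affine_expr_uminus affine_expr_diff affine_expr_sum var
    const radius mass flow flow_Suc dev fin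
  have norm: "affine_expr n M vars e" if "e \<in> norm_constraints nk"
    using that finite_cells by (cases nk) (auto simp: norm_constraints_def intro!: rules)
  show ?thesis
    using assms unfolding constraints_def Un_iff
    by (elim disjE)
      (auto intro!: rules intro: norm sales offered affine_expr_offered)
qed

lemma card_cells: "card cells \<le> (n + M) ^ 2"
proof -
  have "cells \<subseteq> {1..M} \<times> {0..n}" using S_subset by blast
  then have "card cells \<le> M * Suc n" using card_mono[of "{1..M} \<times> {0..n}" cells] by simp
  also have "\<dots> \<le> (n + M) * (n + M)" using M_pos by (intro mult_le_mono) auto
  finally show ?thesis by (simp add: power2_eq_square)
qed

lemma powers_le_cube: "1 \<le> (n + M) ^ 3" "n + M \<le> (n + M) ^ 3" "(n + M) ^ 2 \<le> (n + M) ^ 3"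
  using M_pos power_increasing[of 1 3 "n + M"] power_increasing[of 2 3 "n + M"] by simp_all

lemma card_index_sets:
  "card {0..n} \<le> (n + M) ^ 3" "card ({0..n} \<times> {1..M}) \<le> (n + M) ^ 3"
  "card cells \<le> (n + M) ^ 3" "card ({0..n} \<times> cells) \<le> (n + M) ^ 3"
proof -
  show "card {0..n} \<le> (n + M) ^ 3" using powers_le_cube(2) M_pos by simp
  have "Suc n * M \<le> (n + M) * (n + M)" using M_pos by (intro mult_le_mono) auto
  then show "card ({0..n} \<times> {1..M}) \<le> (n + M) ^ 3"
    using powers_le_cube(3) by (simp add: power2_eq_square)
  show "card cells \<le> (n + M) ^ 3" using card_cells powers_le_cube(3) by linarith
  have "Suc n * card cells \<le> (n + M) * (n + M) ^ 2"
    using M_pos card_cells by (intro mult_le_mono) auto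
  then show "card ({0..n} \<times> cells) \<le> (n + M) ^ 3"
    by (simp add: card_cartesian_product power3_eq_cube power2_eq_square mult.assoc)
qed

lemma card_vars: "card vars \<le> 3 * (n + M) ^ 3"
proof -
  have "card vars \<le> card {0..n} + card ({0..n} \<times> cells) + card cells"
    unfolding vars_def
    by (intro order_trans[OF card_Un_le] add_mono card_image_le finite_cells finite_SigmaI finite_S) auto
  then show ?thesis using card_index_sets by linarith
qed

lemma card_constraints: "card (constraints nk) \<le> 11 * (n + M) ^ 3"
proof -
  let ?N = "(n + M) ^ 3"
  have fin: "finite ({0..n} \<times> cells)" "finite ({0..n} \<times> {1..M})" using finite_cells by simp_all
  have one: "card {e} \<le> ?N" for e :: "var expr" using powers_le_cube(1) by simp
  have norm: "card (norm_constraints nk) \<le> ?N"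
    using powers_le_cube(1) card_image_le[OF finite_cells] card_index_sets(3)
    by (cases nk) (auto simp: norm_constraints_def intro: order_trans)
  have "card (constraints nk) \<le> ?N + ?N + ?N + ?N + ?N + ?N + ?N + ?N + ?N + ?N + ?N"
    unfolding constraints_def
    by (intro order_trans[OF card_Un_le] add_mono one norm
        card_image_le_bound[OF _ fin(1) card_index_sets(4)] card_image_le_bound[OF _ fin(2) card_index_sets(2)]
        card_image_le_bound[OF _ finite_cells card_index_sets(3)] card_image_le_bound[OF _ _ card_index_sets(1)]) auto
  then show ?thesis by simp
qed

end

section \<open>Correctness of the reformulation\<close>

context nested_assortments
begin

text \<open>Every solution of the system describes a distribution: the flows of each \<open>k\<close> are realized by
  a measure on rankings that choose \<open>k\<close>, so in the sum of these measures \<open>k\<close> has demand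
  \<open>Mass k\<close>.\<close>

lemma distribution_of_solution:
  assumes x: "\<And>j. j \<in> {1..n} \<Longrightarrow> x j \<in> {0, 1}"
    and sys: "\<forall>e\<in>constraints nk. e (r, v, \<eta>) x y \<le> 0"
  shows "\<exists>lam\<in>uncertainty_set nk n M S v \<eta>.
    revenue n r lam (assortment_of n x) = (\<Sum>k\<in>{0..n}. r k * y (Mass k))"
proof -
  let ?T = "assortment_of n x"
  note sys' = sys[unfolded constraints_iff]
  have nonneg: "0 \<le> y (Flow k m i)" if "k \<le> n" "(m, i) \<in> cells" for k m i
    using sys' that by fastforce
  have mass: "(\<Sum>i\<in>S m. y (Flow k m i)) = y (Mass k)" if "k \<le> n" "m \<in> {1..M}" for k m
    using sys' that by simp
  have mono: "y (Flow k (Suc m) i) \<le> y (Flow k m i)" if "k \<le> n" "m \<in> {1..<M}" "i \<in> S m" for k m i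
    using sys' that by simp
  have total: "(\<Sum>k\<in>{0..n}. y (Mass k)) = 1" using sys' by simp
  have offer: "y (Mass k) \<le> offered x k" if "k \<le> n" for k using sys' that by simp
  have excl: "y (Flow k m j) \<le> 1 - offered x j" if "k \<le> n" "(m, j) \<in> cells" "k \<in> S m" "j \<noteq> k"
    for k m j
    using sys' that by fastforce
  have dev: "\<bar>(\<Sum>k\<in>{0..n}. y (Flow k m i)) - v m i\<bar> \<le> y (Dev m i)" if "(m, i) \<in> cells" for m i
    using sys' that by fastforce
  have offered: "offered x j = of_bool (j \<in> ?T)" if "j \<le> n" for j
    using x[of j] that by (auto simp: offered_def assortment_of_def)
  have T: "?T \<subseteq> {0..n}" "?T \<noteq> {}" by (auto simp: assortment_of_def)
  have Mass_nonneg: "0 \<le> y (Mass k)" if "k \<le> n" for k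
  proof -
    have "0 \<le> (\<Sum>i\<in>S 1. y (Flow k 1 i))" using nonneg[OF that] M_pos by (intro sum_nonneg) auto
    then show ?thesis using mass[OF that, of 1] M_pos by simp
  qed
  have "realizable ?T k (\<lambda>m i. if m \<le> M then y (Flow k m i) else 0)" (is "realizable _ _ ?p")
    if k: "k \<le> n" for k
  proof (rule mass_profile_realizable[OF T(1)])
    show "mass_profile (y (Mass k)) ?p"
      using mass[OF k] mono[OF k] nonneg[OF k] by (force simp: mass_profile_def)
    show "0 \<le> y (Mass k)" by (rule Mass_nonneg[OF k])
    show "k \<in> ?T" if "0 < y (Mass k)"
    proof (rule ccontr)
      assume "k \<notin> ?T"
      then have "offered x k = 0" using offered[OF k] by (simp only: of_bool_eq)
      then show False using offer[OF k] that by linarith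
    qed
    show "?p m j = 0" if "(m, j) \<in> cells" "k \<in> S m" "j \<in> ?T" "j \<noteq> k" for m j
    proof -
      have "y (Flow k m j) \<le> 0" using excl[OF k that(1,2,4)] offered[of j] that T by auto
      then show ?thesis using nonneg[OF k that(1)] by simp
    qed
  qed
  then have "\<forall>k\<in>{0..n}. \<exists>\<mu>.
      (\<forall>\<sigma>\<in>rankings n. 0 \<le> \<mu> \<sigma> \<and> (\<mu> \<sigma> \<noteq> 0 \<longrightarrow> arg_min_on \<sigma> ?T = k)) \<and>
      (\<forall>(m, i)\<in>cells. demand n \<mu> i (S m) = (if m \<le> M then y (Flow k m i) else 0))"
    by (simp add: realizable_def)
  from bchoice[OF this] obtain \<mu> where \<mu>: "\<forall>k\<in>{0..n}.
      (\<forall>\<sigma>\<in>rankings n. 0 \<le> \<mu> k \<sigma> \<and> (\<mu> k \<sigma> \<noteq> 0 \<longrightarrow> arg_min_on \<sigma> ?T = k)) \<and>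
      (\<forall>(m, i)\<in>cells. demand n (\<mu> k) i (S m) = (if m \<le> M then y (Flow k m i) else 0))"
    by blast
  have \<mu>_nonneg: "0 \<le> \<mu> k \<sigma>" and \<mu>_choice: "\<mu> k \<sigma> \<noteq> 0 \<Longrightarrow> arg_min_on \<sigma> ?T = k"
    if "k \<le> n" "\<sigma> \<in> rankings n" for k \<sigma>
    using bspec[OF \<mu>, of k] that by simp_all
  have dem: "demand n (\<mu> k) i (S m) = y (Flow k m i)" if "k \<le> n" "(m, i) \<in> cells" for k m i
    using bspec[OF \<mu>, of k] that by auto
  have size: "(\<Sum>\<sigma>\<in>rankings n. \<mu> k \<sigma>) = y (Mass k)" if k: "k \<le> n" for k
  proof -
    have one: "1 \<in> {1..M}" using M_pos by simp
    have "(\<Sum>\<sigma>\<in>rankings n. \<mu> k \<sigma>) = (\<Sum>i\<in>S 1. demand n (\<mu> k) i (S 1))"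
      by (rule sum_demand[symmetric]) (use one finite_S zero_in_S in auto)
    also have "\<dots> = (\<Sum>i\<in>S 1. y (Flow k 1 i))"
      using one by (intro sum.cong dem[OF k]) auto
    finally show ?thesis using mass[OF k one] by simp
  qed
  define lam where "lam \<sigma> = (\<Sum>k\<in>{0..n}. \<mu> k \<sigma>)" for \<sigma>
  have demand_lam: "demand n lam i A = (\<Sum>k\<in>{0..n}. demand n (\<mu> k) i A)" for i A
    unfolding lam_def by (rule demand_sum)
  have "(\<Sum>\<sigma>\<in>rankings n. lam \<sigma>) = 1"
    unfolding lam_def using size total by (subst sum.swap) simp
  then have "lam \<in> distributions n"
    using \<mu>_nonneg by (auto simp: distributions_def lam_def intro!: sum_nonneg)
  moreover have "vec_norm nk cells (\<lambda>(m, i). demand n lam i (S m) - v m i) \<le> \<eta>"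
  proof -
    have "\<bar>case c of (m, i) \<Rightarrow> demand n lam i (S m) - v m i\<bar> \<le> (case c of (m, i) \<Rightarrow> y (Dev m i))"
      if "c \<in> cells" for c
      using dev dem that by (auto simp: demand_lam)
    note le = this
    have norm: "case nk of L1 \<Rightarrow> (\<Sum>(m, i)\<in>cells. y (Dev m i)) \<le> \<eta>
        | Linf \<Rightarrow> (\<forall>(m, i)\<in>cells. y (Dev m i) \<le> \<eta>)" using sys' by simp
    show ?thesis
    proof (cases nk)
      case L1
      have "(\<Sum>c\<in>cells. \<bar>case c of (m, i) \<Rightarrow> demand n lam i (S m) - v m i\<bar>)
          \<le> (\<Sum>c\<in>cells. case c of (m, i) \<Rightarrow> y (Dev m i))"
        by (rule sum_mono) (rule le)
      also have "\<dots> \<le> \<eta>" using norm L1 by simp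
      finally show ?thesis using L1 by simp
    next
      case Linf
      have "\<bar>case c of (m, i) \<Rightarrow> demand n lam i (S m) - v m i\<bar> \<le> \<eta>" if "c \<in> cells" for c
      proof -
        have "(case c of (m, i) \<Rightarrow> y (Dev m i)) \<le> \<eta>" using norm that Linf by auto
        then show ?thesis using le[OF that] by linarith
      qed
      then show ?thesis
        unfolding vec_norm_le_iff[OF finite_cells cells_nonempty] Linf norm_kind.case by blast
    qed
  qed
  moreover have "demand n lam k ?T = y (Mass k)" if k: "k \<le> n" for k
  proof -
    have "demand n (\<mu> l) k ?T = (if l = k then y (Mass k) else 0)" if l: "l \<le> n" for l
    proof -
      have "demand n (\<mu> l) k ?T = (\<Sum>\<sigma>\<in>rankings n. if l = k then \<mu> l \<sigma> else 0)"
        unfolding demand_def using \<mu>_choice[OF l] by (intro sum.cong) auto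
      then show ?thesis using size[OF l] by auto
    qed
    then show ?thesis using k by (simp add: demand_lam)
  qed
  then have "revenue n r lam ?T = (\<Sum>k\<in>{0..n}. r k * y (Mass k))" by (simp add: revenue_def)
  ultimately show ?thesis unfolding uncertainty_set_eq by blast
qed

text \<open>Conversely, the flows of a distribution are the joint probabilities of the choices from the
  new and the past assortments. No ranking chooses \<open>k\<close> where \<open>j\<close> is on offer and \<open>j\<close> where \<open>k\<close>
  is, so the flows that the system forbids vanish.\<close>

lemma solution_of_distribution:
  assumes A: "A \<in> assortments n" and lam: "lam \<in> uncertainty_set nk n M S v \<eta>"
  shows "\<exists>y. (\<forall>e\<in>constraints nk. e (r, v, \<eta>) (\<lambda>j. of_bool (j \<in> A)) y \<le> 0) \<and>
    (\<forall>k. y (Mass k) = demand n lam k A)"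
proof -
  define y where "y u = (case u of Mass k \<Rightarrow> demand n lam k A
    | Flow k m i \<Rightarrow> joint_demand n lam k A i (S m)
    | Dev m i \<Rightarrow> \<bar>demand n lam i (S m) - v m i\<bar>)" for u
  have y: "y (Mass k) = demand n lam k A" "y (Flow k m i) = joint_demand n lam k A i (S m)"
    "y (Dev m i) = \<bar>demand n lam i (S m) - v m i\<bar>" for k m i by (simp_all add: y_def)
  have A0: "0 \<in> A" "A \<subseteq> {0..n}" "A \<noteq> {}" using A by (auto simp: assortments_def)
  have dist: "\<And>\<sigma>. \<sigma> \<in> rankings n \<Longrightarrow> 0 \<le> lam \<sigma>" "(\<Sum>\<sigma>\<in>rankings n. lam \<sigma>) = 1"
    using lam by (auto simp: uncertainty_set_eq distributions_def)
  have offered: "offered (\<lambda>j. of_bool (j \<in> A)) j = of_bool (j \<in> A)" for j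
    using A0 by (auto simp: offered_def)
  have le1: "(\<Sum>\<sigma>\<in>rankings n. of_bool (P \<sigma>) * lam \<sigma>) \<le> 1" for P
    unfolding dist(2)[symmetric] using dist(1) by (intro sum_mono) auto
  have marginal: "(\<Sum>k\<in>{0..n}. joint_demand n lam k A i (S m)) = demand n lam i (S m)" for m i
    using sum_joint_demand[of "{0..n}" A n lam i "S m"] A0 by (simp add: joint_demand_commute)
  have "0 \<le> y (Flow k m i)" for k m i
    unfolding y joint_demand_def using dist(1) by (intro sum_nonneg) auto
  moreover have "(\<Sum>i\<in>S m. y (Flow k m i)) = y (Mass k)" if "m \<in> {1..M}" for k m
    unfolding y using finite_S zero_in_S that by (intro sum_joint_demand) auto
  moreover have "y (Flow k (Suc m) i) \<le> y (Flow k m i)" if "m \<in> {1..<M}" "i \<in> S m" for k m i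
    unfolding y joint_demand_def
  proof (intro sum_mono mult_right_mono dist(1))
    fix \<sigma> assume "\<sigma> \<in> rankings n"
    then have "arg_min_on \<sigma> (S m) = i" if "arg_min_on \<sigma> (S (Suc m)) = i"
      using arg_min_on_subset[of \<sigma> n "S m" "S (Suc m)"] S_step that \<open>m \<in> {1..<M}\<close> \<open>i \<in> S m\<close> by auto
    then show "of_bool (k = arg_min_on \<sigma> A \<and> i = arg_min_on \<sigma> (S (Suc m)))
      \<le> (of_bool (k = arg_min_on \<sigma> A \<and> i = arg_min_on \<sigma> (S m)) :: real)" by auto
  qed
  moreover have "(\<Sum>k\<in>{0..n}. y (Mass k)) = 1"
    unfolding y using A0 dist(2) by (subst sum_demand) auto
  moreover have "y (Mass k) \<le> offered (\<lambda>j. of_bool (j \<in> A)) k" for k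
  proof (cases "k \<in> A")
    case True
    then show ?thesis unfolding y offered demand_def by (simp add: le1)
  next
    case False
    then have "k \<noteq> arg_min_on \<sigma> A" for \<sigma> :: "nat \<Rightarrow> nat" using arg_min_on_in[OF A0(3), of \<sigma>] by auto
    then show ?thesis using False unfolding y offered demand_def by simp
  qed
  moreover have "y (Flow k m j) \<le> 1 - offered (\<lambda>j. of_bool (j \<in> A)) j"
    if "(m, j) \<in> cells" "k \<in> S m" "j \<noteq> k" for k m j
  proof (cases "j \<in> A")
    case True
    have "\<not> (k = arg_min_on \<sigma> A \<and> j = arg_min_on \<sigma> (S m))" if \<sigma>: "\<sigma> \<in> rankings n" for \<sigma>
    proof
      assume "k = arg_min_on \<sigma> A \<and> j = arg_min_on \<sigma> (S m)"
      then have "\<sigma> k = \<sigma> j"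
        using arg_min_on_le[OF True, of \<sigma>] arg_min_on_le[OF \<open>k \<in> S m\<close>, of \<sigma>] by simp
      then show False using ranking_inj[OF \<sigma>] \<open>j \<noteq> k\<close> by (simp add: inj_eq)
    qed
    then have "joint_demand n lam k A j (S m) = 0"
      unfolding joint_demand_def by (intro sum.neutral) auto
    then show ?thesis using True unfolding y offered by simp
  next
    case False
    then show ?thesis unfolding y offered joint_demand_def by (simp add: le1)
  qed
  moreover have "\<bar>(\<Sum>k\<in>{0..n}. y (Flow k m i)) - v m i\<bar> \<le> y (Dev m i)" for m i
    unfolding y marginal by simp
  moreover have "case nk of L1 \<Rightarrow> (\<Sum>(m, i)\<in>cells. y (Dev m i)) \<le> \<eta>
      | Linf \<Rightarrow> (\<forall>(m, i)\<in>cells. y (Dev m i) \<le> \<eta>)"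
    using lam unfolding uncertainty_set_eq vec_norm_le_iff[OF finite_cells cells_nonempty]
    by (cases nk) (auto simp: y case_prod_beta)
  ultimately have "\<forall>e\<in>constraints nk. e (r, v, \<eta>) (\<lambda>j. of_bool (j \<in> A)) y \<le> 0"
    unfolding constraints_iff by blast
  then show ?thesis using y(1) by blast
qed

definition cost :: "num_data \<Rightarrow> var \<Rightarrow> real" where
  "cost D u = (case u of Mass k \<Rightarrow> fst D k | _ \<Rightarrow> 0)"

lemma affine_cost: "u \<in> vars \<Longrightarrow> affine_in_data n M (\<lambda>D. cost D u)"
  by (auto simp: vars_def cost_def intro!: affine_revenue affine_const)

lemma objective_eq: "(\<Sum>u\<in>vars. cost (r, v, \<eta>) u * y u) = (\<Sum>k\<in>{0..n}. r k * y (Mass k))"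
proof -
  have "(\<Sum>u\<in>vars. cost (r, v, \<eta>) u * y u) = (\<Sum>u\<in>Mass ` {0..n}. cost (r, v, \<eta>) u * y u)"
    by (rule sum.mono_neutral_right[OF finite_vars]) (auto simp: vars_def cost_def)
  also have "\<dots> = (\<Sum>k\<in>{0..n}. r k * y (Mass k))"
    by (subst sum.reindex) (auto simp: inj_on_def cost_def)
  finally show ?thesis .
qed

lemma reformulation:
  "\<exists>F. milp_template n M n (card vars) (card (constraints nk)) F \<and>
    (\<forall>r v \<eta>. uncertainty_set nk n M S v \<eta> \<noteq> {} \<longrightarrow>
      reformulates_optimistic n r (uncertainty_set nk n M S v \<eta>) (F (r, v, \<eta>)))"
proof -
  obtain F where template: "milp_template n M n (card vars) (card (constraints nk)) F"
    and all: "\<forall>D. nbin (F D) = n \<and>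
      (\<forall>x z. (\<exists>y. (x, y) \<in> milp_feasible (F D) \<and> milp_objective (F D) (x, y) = z) \<longleftrightarrow>
        (\<forall>j\<in>{1..n}. x j \<in> {0, 1}) \<and>
        (\<exists>y. (\<forall>e\<in>constraints nk. e D x y \<le> 0) \<and> (\<Sum>u\<in>vars. cost D u * y u) = z))"
    using ex_milp_template[of vars "constraints nk" n M cost]
      finite_vars finite_constraints affine_constraints affine_cost by blast
  have nbin: "nbin (F D) = n" for D using all by blast
  have F: "(\<exists>y. (x, y) \<in> milp_feasible (F D) \<and> milp_objective (F D) (x, y) = z) \<longleftrightarrow>
        (\<forall>j\<in>{1..n}. x j \<in> {0, 1}) \<and>
        (\<exists>y. (\<forall>e\<in>constraints nk. e D x y \<le> 0) \<and> (\<Sum>u\<in>vars. cost D u * y u) = z)" for D x z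
    using all by blast
  have "reformulates_optimistic n r (uncertainty_set nk n M S v \<eta>) (F (r, v, \<eta>))"
    if ne: "uncertainty_set nk n M S v \<eta> \<noteq> {}" for r v \<eta>
  proof -
    let ?U = "uncertainty_set nk n M S v \<eta>" and ?P = "F (r, v, \<eta>)"
    let ?R = "{revenue n r lam A |A lam. A \<in> assortments n \<and> lam \<in> ?U}"
    have sound: "\<exists>lam\<in>?U. revenue n r lam (assortment_of n x) = milp_objective ?P (x, y)"
      if feasible: "(x, y) \<in> milp_feasible ?P" for x y
    proof -
      obtain y' where "\<forall>j\<in>{1..n}. x j \<in> {0, 1}" "\<forall>e\<in>constraints nk. e (r, v, \<eta>) x y' \<le> 0"
        "(\<Sum>u\<in>vars. cost (r, v, \<eta>) u * y' u) = milp_objective ?P (x, y)"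
        using F[of x "(r, v, \<eta>)" "milp_objective ?P (x, y)"] feasible by blast
      then show ?thesis using distribution_of_solution[of x nk r v \<eta> y'] by (simp add: objective_eq)
    qed
    have complete: "\<exists>x y. (x, y) \<in> milp_feasible ?P \<and> milp_objective ?P (x, y) = revenue n r lam A"
      if A: "A \<in> assortments n" and lam: "lam \<in> ?U" for A lam
    proof -
      let ?x = "\<lambda>j. of_bool (j \<in> A) :: real"
      obtain y where "\<forall>e\<in>constraints nk. e (r, v, \<eta>) ?x y \<le> 0" "\<And>k. y (Mass k) = demand n lam k A"
        using solution_of_distribution[OF A lam] by blast
      moreover from this(2) have "(\<Sum>u\<in>vars. cost (r, v, \<eta>) u * y u) = revenue n r lam A"
        by (simp add: objective_eq revenue_def)
      ultimately show ?thesis using F[of ?x "(r, v, \<eta>)" "revenue n r lam A"] by auto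
    qed
    have assort: "assortment_of n x \<in> assortments n" for x
      by (auto simp: assortment_of_def assortments_def)
    have same_values: "milp_objective ?P ` milp_feasible ?P = ?R"
    proof (intro equalityI subsetI)
      fix w assume "w \<in> milp_objective ?P ` milp_feasible ?P"
      then obtain x y where "(x, y) \<in> milp_feasible ?P" "w = milp_objective ?P (x, y)" by auto
      then obtain lam where "lam \<in> ?U" "w = revenue n r lam (assortment_of n x)"
        using sound by force
      then show "w \<in> ?R" using assort by blast
    next
      fix w assume "w \<in> ?R"
      then obtain x y where "(x, y) \<in> milp_feasible ?P" "milp_objective ?P (x, y) = w"
        using complete by blast
      then show "w \<in> milp_objective ?P ` milp_feasible ?P" by (metis image_eqI)
    qed
    obtain z where z: "is_max ?R z" using optimum_attained[OF finite_cells cells_nonempty ne] by blast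
    have optimal: "is_max ((\<lambda>lam. revenue n r lam (assortment_of n x)) ` ?U) z"
      if "(x, y) \<in> milp_feasible ?P" "milp_objective ?P (x, y) = z" for x y
    proof -
      have "revenue n r lam (assortment_of n x) \<le> z" if "lam \<in> ?U" for lam
        using z assort[of x] that unfolding is_max_def by blast
      moreover have "z \<in> (\<lambda>lam. revenue n r lam (assortment_of n x)) ` ?U"
        using sound[OF that(1)] that(2) by (metis image_eqI)
      ultimately show ?thesis unfolding is_max_def by blast
    qed
    show ?thesis
      unfolding reformulates_optimistic_def same_values
    proof (intro conjI exI[of _ z] z)
      show "n \<le> nbin ?P" by (simp add: nbin)
    qed (use optimal in blast)
  qed
  then show ?thesis using template by blast
qed

end

theorem theorem7:
  "\<exists>C d :: nat. \<forall>(n::nat) (M::nat) (S :: nat \<Rightarrow> nat set) (nk :: norm_kind).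
     1 \<le> n \<longrightarrow> 1 \<le> M \<longrightarrow>
     (\<forall>m\<in>{1..M}. S m \<in> assortments n) \<longrightarrow>
     (\<forall>m\<in>{1..<M}. S m \<subseteq> S (Suc m)) \<longrightarrow>
     (\<exists>p q k F.
        p \<le> C * n \<and> q \<le> C * (n + M) ^ d \<and> k \<le> C * (n + M) ^ d \<and>
        milp_template n M p q k F \<and>
        (\<forall>r v \<eta>. valid_revenues n r \<longrightarrow> valid_sales n M S v \<longrightarrow> 0 \<le> \<eta> \<longrightarrow>
           uncertainty_set nk n M S v \<eta> \<noteq> {} \<longrightarrow>
           reformulates_optimistic n r (uncertainty_set nk n M S v \<eta>) (F (r, v, \<eta>))))"
proof (rule exI[of _ 11], rule exI[of _ 3], intro allI impI)
  \<comment> \<open>There are eleven families of constraints, each with at most \<open>(n + M)\<^sup>3\<close> members.\<close>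
  fix n M :: nat and S :: "nat \<Rightarrow> nat set" and nk
  assume "1 \<le> M" "\<forall>m\<in>{1..M}. S m \<in> assortments n" "\<forall>m\<in>{1..<M}. S m \<subseteq> S (Suc m)"
  then interpret nested_assortments n M S by unfold_locales auto
  obtain F where F: "milp_template n M n (card vars) (card (constraints nk)) F"
    "\<And>r v \<eta>. uncertainty_set nk n M S v \<eta> \<noteq> {} \<Longrightarrow>
      reformulates_optimistic n r (uncertainty_set nk n M S v \<eta>) (F (r, v, \<eta>))"
    using reformulation[of nk] by blast
  have vars_le: "card vars \<le> 11 * (n + M) ^ 3" using card_vars by linarith
  show "\<exists>p q k F.
        p \<le> 11 * n \<and> q \<le> 11 * (n + M) ^ 3 \<and> k \<le> 11 * (n + M) ^ 3 \<and>
        milp_template n M p q k F \<and>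
        (\<forall>r v \<eta>. valid_revenues n r \<longrightarrow> valid_sales n M S v \<longrightarrow> 0 \<le> \<eta> \<longrightarrow>
           uncertainty_set nk n M S v \<eta> \<noteq> {} \<longrightarrow>
           reformulates_optimistic n r (uncertainty_set nk n M S v \<eta>) (F (r, v, \<eta>)))"
  proof (rule exI[of _ n], rule exI[of _ "card vars"], rule exI[of _ "card (constraints nk)"],
      rule exI[of _ F], intro conjI)
  qed (use F vars_le card_constraints in auto)
qed

end
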